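(* Let $\eta\in\mathbb{C}$, $N\in\mathbb{N}^*$, $R_{a,b}(\lambda)=\lambda I_{a,b}+\eta\mathbb{P}_{a,b}$ on $\mathbb{C}^3\otimes\mathbb{C}^3$, let $K$ be a $w$-simple $3\times3$ matrix, let $\xi_1,\dots,\xi_N$ satisfy $\xi_a\neq\xi_b+r\eta$ for all $a\neq b$, $r\in\{-2,-1,0,1,2\}$, let $\mathcal{H}=(\mathbb{C}^3)^{\otimes N}$ and $T_1^{(K)}(\lambda)=\operatorname{tr}_a\big(K_aR_{a,N}(\lambda-\xi_N)\cdots R_{a,1}(\lambda-\xi_1)\big)$. Let $\langle S|\in\mathcal{H}^*$ be such that $\langle h_1,\dots,h_N|:=\langle S|\prod_{n=1}^N(T_1^{(K)}(\xi_n))^{h_n}$, $(h_1,\dots,h_N)\in\{0,1,2\}^N$, is a basis of $\mathcal{H}^*$. Define $g_a(\lambda)=\prod_{b\neq a}\frac{\lambda-\xi_b}{\xi_a-\xi_b}$, $f_a(\lambda)=\prod_{b\neq a}\frac{\lambda-\xi_b+\eta}{\xi_a-\xi_b}\prod_{b=1}^N\frac{\lambda-\xi_b}{\xi_a-\eta-\xi_b}$, $T_2^{\infty}(\lambda)=\frac{(\operatorname{tr}K)^2-\operatorname{tr}K^2}{2}\prod_{n=1}^N(\lambda-\xi_n)(\lambda-\xi_n+\eta)$, and $q(\lambda)=\det K\prod_{b=1}^N(\lambda-\xi_b)(\lambda+\eta-\xi_b)(\lambda+3\eta-\xi_b)$. Then the set of eigenvalues of $T_1^{(K)}(\lambda)$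 is $$\Sigma_{T^{(K)}}=\Big\{t_1(\lambda)=\operatorname{tr}K\prod_{a=1}^N(\lambda-\xi_a)+\sum_{a=1}^Ng_a(\lambda)x_a:(x_1,\dots,x_N)\in\Sigma_T\Big\},$$ where $\Sigma_T$ is the set of solutions $(x_1,\dots,x_N)$ of the $N$ cubic equations $$x_a\Big[T_2^{\infty}(\xi_a-2\eta)+\sum_{n=1}^Nf_n(\xi_a-2\eta)\,t_1(\xi_n-\eta)\,x_n\Big]=q(\xi_a-2\eta),\qquad a=1,\dots,N,$$ with $t_1(\lambda)=\operatorname{tr}K\prod_a(\lambda-\xi_a)+\sum_ag_a(\lambda)x_a$. Moreover $T_1^{(K)}(\lambda)$ is $w$-simple, and for every $t_1\in\Sigma_{T^{(K)}}$ the associated unique (up to normalization) eigenvector $|t\rangle$ satisfies $\langle h_1,\dots,h_N|t\rangle=\prod_{n=1}^Nt_1(\xi_n)^{h_n}$.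
   Context: $w$-simple for the commuting family $T_1^{(K)}(\lambda)$ means each eigenvalue function has exactly one common eigenvector up to scalar. $q(\lambda)$ is the quantum determinant of the monodromy matrix $K_aR_{a,N}(\lambda-\xi_N)\cdots R_{a,1}(\lambda-\xi_1)$. *)

theory Defs
  imports Complex_Main "Jordan_Normal_Form.Matrix" "Jordan_Normal_Form.Determinant"
    "Jordan_Normal_Form.VS_Connect"
begin

text \<open>A basis state of (C^3)^(tensor M) is encoded by an index i < 3^M; its k-th tensor
factor (counting from 0) is the ternary digit k of i.  The quantum space
H = (C^3)^(tensor N) has site n (1 \<le> n \<le> N) at digit n-1.  The space
C^3_a (tensor) H (auxiliary space a tensored with H) has dimension 3^(N+1); the
auxiliary space a is digit 0 and site n is digit n.\<close>

definition digit :: "nat \<Rightarrow> nat \<Rightarrow> nat" where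
  "digit k i = (i div 3 ^ k) mod 3"

definition perm_an :: "nat \<Rightarrow> nat \<Rightarrow> complex mat" where
  "perm_an N n = mat (3 ^ Suc N) (3 ^ Suc N) (\<lambda>(i, j).
      if digit 0 i = digit n j \<and> digit n i = digit 0 j
         \<and> (\<forall>k \<le> N. k \<noteq> 0 \<longrightarrow> k \<noteq> n \<longrightarrow> digit k i = digit k j) then 1 else 0)"

definition R_an :: "nat \<Rightarrow> complex \<Rightarrow> nat \<Rightarrow> complex \<Rightarrow> complex mat" where
  "R_an N \<eta> n z = z \<cdot>\<^sub>m 1\<^sub>m (3 ^ Suc N) + \<eta> \<cdot>\<^sub>m perm_an N n"

definition K_a :: "nat \<Rightarrow> complex mat \<Rightarrow> complex mat" where
  "K_a N K = mat (3 ^ Suc N) (3 ^ Suc N) (\<lambda>(i, j).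
      if i div 3 = j div 3 then K $$ (digit 0 i, digit 0 j) else 0)"

fun R_prod :: "nat \<Rightarrow> complex \<Rightarrow> (nat \<Rightarrow> complex) \<Rightarrow> complex \<Rightarrow> nat \<Rightarrow> complex mat" where
  "R_prod N \<eta> \<xi> z 0 = 1\<^sub>m (3 ^ Suc N)"
| "R_prod N \<eta> \<xi> z (Suc m) = R_an N \<eta> (Suc m) (z - \<xi> (Suc m)) * R_prod N \<eta> \<xi> z m"

definition monodromy :: "nat \<Rightarrow> complex \<Rightarrow> (nat \<Rightarrow> complex) \<Rightarrow> complex mat \<Rightarrow> complex \<Rightarrow> complex mat" where
  "monodromy N \<eta> \<xi> K z = K_a N K * R_prod N \<eta> \<xi> z N"

definition ptrace_a :: "nat \<Rightarrow> complex mat \<Rightarrow> complex mat" where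
  "ptrace_a N M = mat (3 ^ N) (3 ^ N) (\<lambda>(i, j). \<Sum>c<3. M $$ (c + 3 * i, c + 3 * j))"

definition T1K :: "nat \<Rightarrow> complex \<Rightarrow> (nat \<Rightarrow> complex) \<Rightarrow> complex mat \<Rightarrow> complex \<Rightarrow> complex mat" where
  "T1K N \<eta> \<xi> K z = ptrace_a N (monodromy N \<eta> \<xi> K z)"

definition is_common_eigenvector ::
  "nat \<Rightarrow> ('b \<Rightarrow> complex mat) \<Rightarrow> ('b \<Rightarrow> complex) \<Rightarrow> complex vec \<Rightarrow> bool" where
  "is_common_eigenvector n F t v \<longleftrightarrow>
     v \<in> carrier_vec n \<and> v \<noteq> 0\<^sub>v n \<and> (\<forall>z. F z *\<^sub>v v = t z \<cdot>\<^sub>v v)"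

definition eigenvalues_family :: "nat \<Rightarrow> ('b \<Rightarrow> complex mat) \<Rightarrow> ('b \<Rightarrow> complex) set" where
  "eigenvalues_family n F = {t. \<exists>v. is_common_eigenvector n F t v}"

definition w_simple_family :: "nat \<Rightarrow> ('b \<Rightarrow> complex mat) \<Rightarrow> bool" where
  "w_simple_family n F \<longleftrightarrow>
     (\<forall>t \<in> eigenvalues_family n F. \<forall>v w.
        is_common_eigenvector n F t v \<longrightarrow> is_common_eigenvector n F t w \<longrightarrow>
        (\<exists>c. w = c \<cdot>\<^sub>v v))"

definition w_simple_mat :: "nat \<Rightarrow> complex mat \<Rightarrow> bool" where
  "w_simple_mat n K \<longleftrightarrow> K \<in> carrier_mat n n \<and> w_simple_family n (\<lambda>_::unit. K)"

definition covec_mult :: "complex vec \<Rightarrow> complex mat \<Rightarrow> complex vec" where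
  "covec_mult S A = vec (dim_col A) (\<lambda>j. S \<bullet> col A j)"

fun T_power_prod :: "nat \<Rightarrow> complex \<Rightarrow> (nat \<Rightarrow> complex) \<Rightarrow> complex mat \<Rightarrow> (nat \<Rightarrow> nat) \<Rightarrow> nat \<Rightarrow> complex mat" where
  "T_power_prod N \<eta> \<xi> K h 0 = 1\<^sub>m (3 ^ N)"
| "T_power_prod N \<eta> \<xi> K h (Suc m) =
     T_power_prod N \<eta> \<xi> K h m * (T1K N \<eta> \<xi> K (\<xi> (Suc m)) ^\<^sub>m h (Suc m))"

definition SoV_covector :: "nat \<Rightarrow> complex \<Rightarrow> (nat \<Rightarrow> complex) \<Rightarrow> complex mat \<Rightarrow> complex vec \<Rightarrow> (nat \<Rightarrow> nat) \<Rightarrow> complex vec" where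
  "SoV_covector N \<eta> \<xi> K S h = covec_mult S (T_power_prod N \<eta> \<xi> K h N)"

definition tuples012 :: "nat \<Rightarrow> (nat \<Rightarrow> nat) set" where
  "tuples012 N = {h. (\<forall>n \<in> {1..N}. h n \<le> 2) \<and> (\<forall>n. n \<notin> {1..N} \<longrightarrow> h n = 0)}"

text \<open>The family (<h|)_{h in {0,1,2}^N} is a basis of H* = C^(3^N): injective as a family,
and its set of members is a basis of the vector space C^(3^N).\<close>
definition is_SoV_basis :: "nat \<Rightarrow> complex \<Rightarrow> (nat \<Rightarrow> complex) \<Rightarrow> complex mat \<Rightarrow> complex vec \<Rightarrow> bool" where
  "is_SoV_basis N \<eta> \<xi> K S \<longleftrightarrow>
     S \<in> carrier_vec (3 ^ N) \<and>
     inj_on (SoV_covector N \<eta> \<xi> K S) (tuples012 N) \<and>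
     vectorspace.basis class_ring (module_vec TYPE(complex) (3 ^ N)) (SoV_covector N \<eta> \<xi> K S ` tuples012 N)"

definition mat_tr :: "complex mat \<Rightarrow> complex" where
  "mat_tr A = (\<Sum>i < dim_row A. A $$ (i, i))"


definition g_fun :: "nat \<Rightarrow> (nat \<Rightarrow> complex) \<Rightarrow> nat \<Rightarrow> complex \<Rightarrow> complex" where
  "g_fun N \<xi> a z = (\<Prod>b \<in> {1..N} - {a}. (z - \<xi> b) / (\<xi> a - \<xi> b))"

definition f_fun :: "nat \<Rightarrow> complex \<Rightarrow> (nat \<Rightarrow> complex) \<Rightarrow> nat \<Rightarrow> complex \<Rightarrow> complex" where
  "f_fun N \<eta> \<xi> a z = (\<Prod>b \<in> {1..N} - {a}. (z - \<xi> b + \<eta>) / (\<xi> a - \<xi> b)) *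
                      (\<Prod>b \<in> {1..N}. (z - \<xi> b) / (\<xi> a - \<eta> - \<xi> b))"

definition T2_inf :: "nat \<Rightarrow> complex \<Rightarrow> (nat \<Rightarrow> complex) \<Rightarrow> complex mat \<Rightarrow> complex \<Rightarrow> complex" where
  "T2_inf N \<eta> \<xi> K z = ((mat_tr K)\<^sup>2 - mat_tr (K * K)) / 2 *
                       (\<Prod>n \<in> {1..N}. (z - \<xi> n) * (z - \<xi> n + \<eta>))"

definition q_det :: "nat \<Rightarrow> complex \<Rightarrow> (nat \<Rightarrow> complex) \<Rightarrow> complex mat \<Rightarrow> complex \<Rightarrow> complex" where
  "q_det N \<eta> \<xi> K z = det K * (\<Prod>b \<in> {1..N}. (z - \<xi> b) * (z + \<eta> - \<xi> b) * (z + 3 * \<eta> - \<xi> b))"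

definition t1_of :: "nat \<Rightarrow> (nat \<Rightarrow> complex) \<Rightarrow> complex mat \<Rightarrow> (nat \<Rightarrow> complex) \<Rightarrow> complex \<Rightarrow> complex" where
  "t1_of N \<xi> K x z = mat_tr K * (\<Prod>a \<in> {1..N}. (z - \<xi> a)) + (\<Sum>a \<in> {1..N}. g_fun N \<xi> a z * x a)"

definition Sigma_T :: "nat \<Rightarrow> complex \<Rightarrow> (nat \<Rightarrow> complex) \<Rightarrow> complex mat \<Rightarrow> (nat \<Rightarrow> complex) set" where
  "Sigma_T N \<eta> \<xi> K = {x. (\<forall>n. n \<notin> {1..N} \<longrightarrow> x n = 0) \<and>
     (\<forall>a \<in> {1..N}.
        x a * (T2_inf N \<eta> \<xi> K (\<xi> a - 2 * \<eta>) +
               (\<Sum>n \<in> {1..N}. f_fun N \<eta> \<xi> n (\<xi> a - 2 * \<eta>) * t1_of N \<xi> K x (\<xi> n - \<eta>) * x n))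
        = q_det N \<eta> \<xi> K (\<xi> a - 2 * \<eta>))}"

end

theory Submission
  imports Defs
begin

text \<open>
The entries \<open>M\<^sub>i\<^sub>j(z)\<close> of the monodromy matrix satisfy the RTT relation.  At \<open>w = z + \<eta>\<close> this relation makes
the quantum minors alternating in their columns.  At \<open>z = \<xi>\<^sub>n - \<eta>\<close> the product \<open>M\<^sub>i\<^sub>j(z) M\<^sub>k\<^sub>l(z + \<eta>)\<close> is itself
alternating in \<open>j, l\<close>, since the Lax operator of site \<open>n\<close> degenerates there.  With \<open>T\<^sub>2\<close> the trace of the quantum
minors this gives \<open>T\<^sub>2(\<xi>\<^sub>n) = 0\<close>, \<open>T\<^sub>2(\<xi>\<^sub>n - \<eta>) = T\<^sub>1(\<xi>\<^sub>n - \<eta>) T\<^sub>1(\<xi>\<^sub>n)\<close> and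
\<open>T\<^sub>2(\<xi>\<^sub>n - 2\<eta>) T\<^sub>1(\<xi>\<^sub>n) = q(\<xi>\<^sub>n - 2\<eta>)\<close>.  Interpolating \<open>T\<^sub>1\<close> and \<open>T\<^sub>2\<close> through these nodes turns the
relations into the cubic system, so every eigenvalue solves it.

Conversely a solution \<open>x\<close> defines a vector \<open>|t\<rangle>\<close> by \<open>\<langle>h|t\<rangle> = \<Prod> x\<^sub>n ^ h\<^sub>n\<close>, and \<open>\<langle>h|T\<^sub>1(z)|t\<rangle> = t\<^sub>1(z) \<langle>h|t\<rangle>\<close> holds
because both sides are polynomials in \<open>z\<close> with the same leading coefficient that agree at \<open>N\<close> nodes, chosen
according to \<open>h\<close>.  The case \<open>\<eta> = 0\<close> is excluded since then \<open>T\<^sub>1(\<xi>\<^sub>n) = 0\<close>, so the covectors are no basis.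
\<close>

section \<open>Linear endomorphisms as a ring\<close>

text \<open>Operators form a type of class \<open>ring_1\<close>, so noncommutative identities can
  be rewritten without dimension or carrier conditions. The price is an action on all functions on
  the index type; matrices of size \<open>3 ^ N\<close> are recovered later by restriction.\<close>

typedef 'i endo = "{F :: ('i \<Rightarrow> complex) \<Rightarrow> ('i \<Rightarrow> complex).
    (\<forall>f g. F (\<lambda>p. f p + g p) = (\<lambda>p. F f p + F g p)) \<and>
    (\<forall>c f. F (\<lambda>p. c * f p) = (\<lambda>p. c * F f p))}"
  morphisms app Abs_endo
  by (rule exI[of _ "\<lambda>f. f"]) auto

setup_lifting type_definition_endo

lemma app_add: "app A (\<lambda>p. f p + g p) = (\<lambda>p. app A f p + app A g p)"
  and app_cmult: "app A (\<lambda>p. c * f p) = (\<lambda>p. c * app A f p)"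
  using app[of A] by auto

lemma app_sum: "finite I \<Longrightarrow> app A (\<lambda>p. \<Sum>i\<in>I. f i p) = (\<lambda>p. \<Sum>i\<in>I. app A (f i) p)"
proof (induction I rule: finite_induct)
  case empty
  show ?case using app_cmult[of A 0 "\<lambda>p. 0"] by simp
next
  case (insert i I)
  then show ?case by (simp add: app_add)
qed

lemma endo_eqI: "(\<And>f p. app A f p = app B f p) \<Longrightarrow> A = B"
  by (metis app_inject ext)

instantiation endo :: (type) ring_1
begin

lift_definition zero_endo :: "'a endo" is "\<lambda>f p. 0" by auto
lift_definition one_endo :: "'a endo" is "\<lambda>f. f" by auto
lift_definition plus_endo :: "'a endo \<Rightarrow> 'a endo \<Rightarrow> 'a endo" is "\<lambda>F G f p. F f p + G f p"
  by (auto simp: algebra_simps)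
lift_definition minus_endo :: "'a endo \<Rightarrow> 'a endo \<Rightarrow> 'a endo" is "\<lambda>F G f p. F f p - G f p"
  by (auto simp: algebra_simps)
lift_definition uminus_endo :: "'a endo \<Rightarrow> 'a endo" is "\<lambda>F f p. - F f p"
  by (auto simp: algebra_simps)
lift_definition times_endo :: "'a endo \<Rightarrow> 'a endo \<Rightarrow> 'a endo" is "\<lambda>F G f. F (G f)"
  by auto

lemmas endo_rep_eqs = zero_endo.rep_eq one_endo.rep_eq plus_endo.rep_eq minus_endo.rep_eq
  uminus_endo.rep_eq times_endo.rep_eq

instance
proof
  have "app (0::'a endo) (\<lambda>p. 1) undefined \<noteq> app 1 (\<lambda>p. 1) undefined"
    by (simp add: endo_rep_eqs)
  then show "(0::'a endo) \<noteq> 1" by metis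
qed (rule endo_eqI; simp add: endo_rep_eqs app_add algebra_simps)+

end

lift_definition scale :: "complex \<Rightarrow> 'i endo \<Rightarrow> 'i endo"  (infixr "*\<^sub>c" 75)
  is "\<lambda>c F f p. c * F f p"
  by (auto simp: algebra_simps)

lemma app_simps [simp]:
  "app 0 f p = 0" "app 1 f = f" "app (A + B) f p = app A f p + app B f p"
  "app (A - B) f p = app A f p - app B f p" "app (- A) f p = - app A f p"
  "app (A * B) f = app A (app B f)" "app (c *\<^sub>c A) f p = c * app A f p"
  by (simp_all add: endo_rep_eqs scale.rep_eq)

lemma app_sum_endo [simp]: "app (\<Sum>i\<in>I. A i) f p = (\<Sum>i\<in>I. app (A i) f p)"
  by (induction I rule: infinite_finite_induct) auto

interpretation endo: vector_space scale
  by unfold_locales (auto intro!: endo_eqI simp: algebra_simps)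

lemma mult_scale_left [simp]: "(c *\<^sub>c A) * B = c *\<^sub>c (A * B)"
  by (rule endo_eqI) simp

lemma mult_scale_right [simp]: "A * (c *\<^sub>c B) = c *\<^sub>c (A * B)"
  by (rule endo_eqI) (simp add: scale.rep_eq app_cmult)

section \<open>The RTT relation and quantum minors\<close>

lemma sum3: "(\<Sum>c<3. f c) = f 0 + f 1 + f (2::nat)"
  by (simp add: eval_nat_numeral add.assoc)

lemma endo_double: "A + A = B + B \<Longrightarrow> A = (B :: 'i endo)"
proof (rule endo_eqI)
  fix f p assume "A + A = B + B"
  then have "app (A + A) f p = app (B + B) f p" by simp
  then show "app A f p = app B f p" by simp
qed

lemma endo_eq_minus_self: "A = - A \<Longrightarrow> A = (0 :: 'i endo)"
  by (metis add.right_inverse add_0 endo_double)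

text \<open>Components of \<open>R\<^sub>a\<^sub>b(z - w) M\<^sub>a(z) M\<^sub>b(w) = M\<^sub>b(w) M\<^sub>a(z) R\<^sub>a\<^sub>b(z - w)\<close>.\<close>

definition rtt :: "complex \<Rightarrow> (complex \<Rightarrow> nat \<Rightarrow> nat \<Rightarrow> 'i endo) \<Rightarrow> bool" where
  "rtt \<eta> M \<longleftrightarrow> (\<forall>z w. \<forall>i<3. \<forall>j<3. \<forall>k<3. \<forall>l<3.
     (z - w) *\<^sub>c (M z i j * M w k l) + \<eta> *\<^sub>c (M z k j * M w i l) =
     (z - w) *\<^sub>c (M w k l * M z i j) + \<eta> *\<^sub>c (M w k j * M z i l))"

lemma rttD:
  "rtt \<eta> M \<Longrightarrow> i < 3 \<Longrightarrow> j < 3 \<Longrightarrow> k < 3 \<Longrightarrow> l < 3 \<Longrightarrow>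
     (z - w) *\<^sub>c (M z i j * M w k l) + \<eta> *\<^sub>c (M z k j * M w i l) =
     (z - w) *\<^sub>c (M w k l * M z i j) + \<eta> *\<^sub>c (M w k j * M z i l)"
  by (simp add: rtt_def)

definition mprod ::
  "(complex \<Rightarrow> nat \<Rightarrow> nat \<Rightarrow> 'i endo) \<Rightarrow> (complex \<Rightarrow> nat \<Rightarrow> nat \<Rightarrow> 'i endo) \<Rightarrow> complex \<Rightarrow> nat \<Rightarrow> nat \<Rightarrow> 'i endo" where
  "mprod A B z i j = (\<Sum>c<3. A z i c * B z c j)"

definition entries_commute ::
  "(complex \<Rightarrow> nat \<Rightarrow> nat \<Rightarrow> 'i endo) \<Rightarrow> (complex \<Rightarrow> nat \<Rightarrow> nat \<Rightarrow> 'i endo) \<Rightarrow> bool" where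
  "entries_commute A B \<longleftrightarrow> (\<forall>z w. \<forall>i<3. \<forall>j<3. \<forall>k<3. \<forall>l<3. A z i j * B w k l = B w k l * A z i j)"

lemma mprod_mult:
  assumes "entries_commute A B" "j < 3" "k < 3"
  shows "mprod A B z i j * mprod A B w k l =
    (\<Sum>c<3. \<Sum>d<3. (A z i c * A w k d) * (B z c j * B w d l))"
proof -
  have "A z i c * B z c j * (A w k d * B w d l) = (A z i c * A w k d) * (B z c j * B w d l)"
    if "c < 3" "d < 3" for c d
  proof -
    have "B z c j * A w k d = A w k d * B z c j"
      using assms that by (auto simp: entries_commute_def)
    then show ?thesis by (metis mult.assoc)
  qed
  then show ?thesis by (auto simp: mprod_def sum_product intro!: sum.cong)
qed

lemma mprod_mult3:
  assumes AB: "entries_commute A B" and "i < 3" "j < 3" "k < 3" "l < 3" "m < 3" "n < 3"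
  shows "mprod A B z i l * mprod A B w j m * mprod A B v k n =
    (\<Sum>c<3. \<Sum>d<3. \<Sum>e<3. (A z i c * A w j d * A v k e) * (B z c l * B w d m * B v e n))"
proof -
  have "(A z i c * A w j d) * (B z c l * B w d m) * (A v k e * B v e n) =
      (A z i c * A w j d * A v k e) * (B z c l * B w d m * B v e n)"
    if "c < 3" "d < 3" "e < 3" for c d e
  proof -
    have "B z c l * A v k e = A v k e * B z c l" "B w d m * A v k e = A v k e * B w d m"
      using assms that by (auto simp: entries_commute_def)
    then show ?thesis by (metis mult.assoc)
  qed
  moreover have "(\<Sum>c<3. \<Sum>d<3. X c d) * (\<Sum>e<3. Y e) = (\<Sum>c<3. \<Sum>d<3. \<Sum>e<3. X c d * Y e)"
    for X :: "nat \<Rightarrow> nat \<Rightarrow> 'a endo" and Y :: "nat \<Rightarrow> 'a endo"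
    by (simp only: sum_distrib_right) (simp only: sum_distrib_left)
  ultimately show ?thesis
    using assms by (simp add: mprod_mult mprod_def[of A B v])
qed

text \<open>The coproduct property: entries of \<open>A\<close> and \<open>B\<close> commute, so the
  exchange relation can be applied to the \<open>A\<close> factors first and to the \<open>B\<close>
  factors afterwards.\<close>

lemma rtt_mprod:
  assumes A: "rtt \<eta> A" and B: "rtt \<eta> B" and AB: "entries_commute A B"
  shows "rtt \<eta> (mprod A B)"
  unfolding rtt_def
proof (intro allI impI)
  fix z w and i j k l :: nat
  assume ijkl: "i < 3" "j < 3" "k < 3" "l < 3"
  have "(z - w) *\<^sub>c (mprod A B z i j * mprod A B w k l) + \<eta> *\<^sub>c (mprod A B z k j * mprod A B w i l)
      = (\<Sum>c<3. \<Sum>d<3. ((z - w) *\<^sub>c (A z i c * A w k d) + \<eta> *\<^sub>c (A z k c * A w i d)) * (B z c j * B w d l))"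
    using ijkl by (simp add: mprod_mult[OF AB] endo.scale_sum_right sum.distrib distrib_right)
  also have "\<dots> = (\<Sum>c<3. \<Sum>d<3. ((z - w) *\<^sub>c (A w k d * A z i c) + \<eta> *\<^sub>c (A w k c * A z i d)) * (B z c j * B w d l))"
    using ijkl by (intro sum.cong refl) (simp add: rttD[OF A])
  also have "\<dots> = (\<Sum>c<3. \<Sum>d<3. (A w k d * A z i c) * (z - w) *\<^sub>c (B z c j * B w d l))
       + (\<Sum>c<3. \<Sum>d<3. (A w k c * A z i d) * \<eta> *\<^sub>c (B z c j * B w d l))"
    by (simp add: sum.distrib distrib_right)
  \<comment> \<open>Renaming the summed indices of the exchange term gives both sums the left factor
    \<open>A w k d * A z i c\<close>, so that the relation for \<open>B\<close> becomes
    applicable.\<close>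
  also have "(\<Sum>c<3. \<Sum>d<3. (A w k c * A z i d) * \<eta> *\<^sub>c (B z c j * B w d l))
     = (\<Sum>c<3. \<Sum>d<3. (A w k d * A z i c) * \<eta> *\<^sub>c (B z d j * B w c l))"
    by (rule sum.swap)
  also have "(\<Sum>c<3. \<Sum>d<3. (A w k d * A z i c) * (z - w) *\<^sub>c (B z c j * B w d l)) + \<dots>
     = (\<Sum>c<3. \<Sum>d<3. (A w k d * A z i c) * ((z - w) *\<^sub>c (B z c j * B w d l) + \<eta> *\<^sub>c (B z d j * B w c l)))"
    by (simp add: sum.distrib distrib_left)
  also have "\<dots> = (\<Sum>c<3. \<Sum>d<3. (A w k d * A z i c) * ((z - w) *\<^sub>c (B w d l * B z c j) + \<eta> *\<^sub>c (B w d j * B z c l)))"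
    using ijkl by (intro sum.cong refl) (simp add: rttD[OF B])
  also have "\<dots> = (\<Sum>d<3. \<Sum>c<3. (A w k d * A z i c) * ((z - w) *\<^sub>c (B w d l * B z c j) + \<eta> *\<^sub>c (B w d j * B z c l)))"
    by (rule sum.swap)
  also have "\<dots> = (z - w) *\<^sub>c (mprod A B w k l * mprod A B z i j) + \<eta> *\<^sub>c (mprod A B w k j * mprod A B z i l)"
    using ijkl by (simp add: mprod_mult[OF AB] endo.scale_sum_right sum.distrib distrib_left)
  finally show "(z - w) *\<^sub>c (mprod A B z i j * mprod A B w k l) + \<eta> *\<^sub>c (mprod A B z k j * mprod A B w i l)
      = (z - w) *\<^sub>c (mprod A B w k l * mprod A B z i j) + \<eta> *\<^sub>c (mprod A B w k j * mprod A B z i l)" .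
qed

text \<open>Summing the relation over diagonal columns, and again with the two columns exchanged,
  gives a linear system for the differences \<open>a - b\<close> and \<open>c - d\<close>. Its
  determinant is (z - w)^2 - \<eta>^2.\<close>

lemma rtt_trace_commute:
  assumes M: "rtt \<eta> M" and zw: "(z - w)\<^sup>2 \<noteq> \<eta>\<^sup>2"
  shows "(\<Sum>i<3. M z i i) * (\<Sum>k<3. M w k k) = (\<Sum>k<3. M w k k) * (\<Sum>i<3. M z i i)"
proof (rule endo_eqI)
  fix f p
  define a where "a = (\<Sum>i<3. \<Sum>k<3. M z i i * M w k k)"
  define b where "b = (\<Sum>i<3. \<Sum>k<3. M w k k * M z i i)"
  define c where "c = (\<Sum>i<3. \<Sum>k<3. M z k i * M w i k)"
  define d where "d = (\<Sum>i<3. \<Sum>k<3. M w k i * M z i k)"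
  have "(z - w) *\<^sub>c a + \<eta> *\<^sub>c c = (z - w) *\<^sub>c b + \<eta> *\<^sub>c d"
    unfolding a_def b_def c_def d_def endo.scale_sum_right sum.distrib[symmetric]
    by (intro sum.cong refl rttD[OF M]) auto
  then have 1: "(z - w) * app a f p + \<eta> * app c f p = (z - w) * app b f p + \<eta> * app d f p"
    by (metis app_simps(3,7))
  have "(z - w) *\<^sub>c (\<Sum>k<3. \<Sum>i<3. M z i k * M w k i) + \<eta> *\<^sub>c (\<Sum>k<3. \<Sum>i<3. M z k k * M w i i)
      = (z - w) *\<^sub>c (\<Sum>k<3. \<Sum>i<3. M w k i * M z i k) + \<eta> *\<^sub>c (\<Sum>k<3. \<Sum>i<3. M w k k * M z i i)"
    unfolding endo.scale_sum_right sum.distrib[symmetric]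
    by (intro sum.cong refl rttD[OF M]) auto
  also have "(\<Sum>k<3. \<Sum>i<3. M w k i * M z i k) = d"
    unfolding d_def by (rule sum.swap)
  also have "(\<Sum>k<3. \<Sum>i<3. M w k k * M z i i) = b"
    unfolding b_def by (rule sum.swap)
  finally have "(z - w) *\<^sub>c c + \<eta> *\<^sub>c a = (z - w) *\<^sub>c d + \<eta> *\<^sub>c b"
    by (simp add: a_def c_def)
  then have 2: "(z - w) * app c f p + \<eta> * app a f p = (z - w) * app d f p + \<eta> * app b f p"
    by (metis app_simps(3,7))
  from 1 2 have "((z - w)\<^sup>2 - \<eta>\<^sup>2) * (app a f p - app b f p) = 0"
  proof -
    have "((z - w)\<^sup>2 - \<eta>\<^sup>2) * (app a f p - app b f p) =
        (z - w) * (((z - w) * app a f p + \<eta> * app c f p) - ((z - w) * app b f p + \<eta> * app d f p)) -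
        \<eta> * (((z - w) * app c f p + \<eta> * app a f p) - ((z - w) * app d f p + \<eta> * app b f p))"
      by (simp add: power2_eq_square algebra_simps)
    then show ?thesis using 1 2 by simp
  qed
  with zw have "app a f p = app b f p" by simp
  also have "b = (\<Sum>k<3. \<Sum>i<3. M w k k * M z i i)" unfolding b_def by (rule sum.swap)
  finally show "app ((\<Sum>i<3. M z i i) * (\<Sum>k<3. M w k k)) f p = app ((\<Sum>k<3. M w k k) * (\<Sum>i<3. M z i i)) f p"
    unfolding a_def sum_product .
qed

section \<open>Quantum minors: antisymmetry in the columns, vanishing, products\<close>

definition minor :: "complex \<Rightarrow> (complex \<Rightarrow> nat \<Rightarrow> nat \<Rightarrow> 'i endo) \<Rightarrow> complex \<Rightarrow> nat \<Rightarrow> nat \<Rightarrow> nat \<Rightarrow> nat \<Rightarrow> 'i endo" where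
  "minor \<eta> M z i k j l = M z i j * M (z + \<eta>) k l - M z k j * M (z + \<eta>) i l"

text \<open>At \<open>w = z + \<eta>\<close> the left side of the RTT relation is -\<eta> times the
  minor, while the right side changes sign when \<open>j\<close> and \<open>l\<close> are
  exchanged.\<close>

lemma minor_swap_cols:
  assumes M: "rtt \<eta> M" and "\<eta> \<noteq> 0" "i < 3" "j < 3" "k < 3" "l < 3"
  shows "minor \<eta> M z i k j l = - minor \<eta> M z i k l j"
proof (rule endo_eqI)
  fix f p
  let ?w = "z + \<eta>"
  have rel: "\<eta> * app (M z k j) (app (M ?w i l) f) p - \<eta> * app (M z i j) (app (M ?w k l) f) p =
      \<eta> * app (M ?w k j) (app (M z i l) f) p - \<eta> * app (M ?w k l) (app (M z i j) f) p"
    if "j < 3" "l < 3" for j l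
    using arg_cong[OF rttD[OF M \<open>i < 3\<close> \<open>j < 3\<close> \<open>k < 3\<close> \<open>l < 3\<close>, of z ?w], of "\<lambda>A. app A f p"]
    by simp
  have "\<eta> * (a - b) = \<eta> * - (a' - b')"
    if "\<eta> * b - \<eta> * a = c" "\<eta> * b' - \<eta> * a' = - c" for a b a' b' c
    using that(2) unfolding that(1)[symmetric] by (simp add: right_diff_distrib)
  from this[OF rel[OF \<open>j < 3\<close> \<open>l < 3\<close>]] rel[OF \<open>l < 3\<close> \<open>j < 3\<close>]
  have "\<eta> * app (minor \<eta> M z i k j l) f p = \<eta> * app (- minor \<eta> M z i k l j) f p"
    unfolding minor_def app_simps by simp
  then show "app (minor \<eta> M z i k j l) f p = app (- minor \<eta> M z i k l j) f p"
    using mult_left_cancel[OF \<open>\<eta> \<noteq> 0\<close>] by blast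
qed

lemma minor_mprod:
  assumes "entries_commute A B" "i < 3" "j < 3" "k < 3" "l < 3"
  shows "minor \<eta> (mprod A B) z i k j l =
    (\<Sum>c<3. \<Sum>d<3. minor \<eta> A z i k c d * (B z c j * B (z + \<eta>) d l))"
  using assms by (simp add: minor_def mprod_mult sum_subtractf left_diff_distrib)

text \<open>Against an alternating \<open>X\<close> only the alternating part of \<open>Y\<close>
  survives. The left side is doubled to avoid a factor 1/2.\<close>

lemma sum_alternating:
  fixes X Y :: "nat \<Rightarrow> nat \<Rightarrow> 'i endo"
  assumes "\<And>c d. c < 3 \<Longrightarrow> d < 3 \<Longrightarrow> X c d = - X d c"
  shows "(\<Sum>c<3. \<Sum>d<3. X c d * Y c d) + (\<Sum>c<3. \<Sum>d<3. X c d * Y c d) =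
    (\<Sum>c<3. \<Sum>d<3. X c d * (Y c d - Y d c))"
proof -
  have "(\<Sum>c<3. \<Sum>d<3. X c d * Y c d) = (\<Sum>c<3. \<Sum>d<3. X d c * Y d c)"
    by (rule sum.swap)
  also have "\<dots> = (\<Sum>c<3. \<Sum>d<3. - (X c d * Y d c))"
    using assms by (intro sum.cong refl) (metis lessThan_iff minus_mult_left)
  finally show ?thesis
    by (simp add: right_diff_distrib sum_subtractf sum_negf)
qed

text \<open>A quantum Cauchy-Binet argument: the minors of \<open>A\<close> alternate in the summed
  columns, which antisymmetrises the \<open>B\<close> products into minors of
  \<open>B\<close>.\<close>

lemma minor_mprod_right_zero:
  assumes "rtt \<eta> A" "\<eta> \<noteq> 0" "entries_commute A B" "i < 3" "j < 3" "k < 3" "l < 3"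
    and B: "\<And>i k j l. i < 3 \<Longrightarrow> k < 3 \<Longrightarrow> j < 3 \<Longrightarrow> l < 3 \<Longrightarrow> minor \<eta> B z i k j l = 0"
  shows "minor \<eta> (mprod A B) z i k j l = 0"
proof -
  let ?m = "minor \<eta> (mprod A B) z i k j l"
  have "?m + ?m = (\<Sum>c<3. \<Sum>d<3. minor \<eta> A z i k c d *
      (B z c j * B (z + \<eta>) d l - B z d j * B (z + \<eta>) c l))"
    using assms(1-7) unfolding minor_mprod[OF assms(3-7)]
    by (intro sum_alternating minor_swap_cols) auto
  also have "\<dots> = 0"
    using B assms(4-7) by (intro sum.neutral ballI) (simp add: minor_def)
  finally show ?thesis using endo_double[of ?m 0] by simp
qed

lemma minor_mprod_left_zero:
  assumes "entries_commute A B" "i < 3" "j < 3" "k < 3" "l < 3"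
    and "\<And>i k j l. i < 3 \<Longrightarrow> k < 3 \<Longrightarrow> j < 3 \<Longrightarrow> l < 3 \<Longrightarrow> minor \<eta> A z i k j l = 0"
  shows "minor \<eta> (mprod A B) z i k j l = 0"
  using assms by (simp add: minor_mprod)

text \<open>Here the single products alternate, not just their antisymmetrisation in the rows. This
  is a condition at one point \<open>z\<close>, met where a Lax operator degenerates.\<close>

definition col_alternating :: "complex \<Rightarrow> (complex \<Rightarrow> nat \<Rightarrow> nat \<Rightarrow> 'i endo) \<Rightarrow> complex \<Rightarrow> bool" where
  "col_alternating \<eta> M z \<longleftrightarrow> (\<forall>i<3. \<forall>j<3. \<forall>k<3. \<forall>l<3.
     M z i j * M (z + \<eta>) k l = - (M z i l * M (z + \<eta>) k j))"

lemma col_alternating_mprod_right: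
  assumes "entries_commute A B" "col_alternating \<eta> B z"
  shows "col_alternating \<eta> (mprod A B) z"
  unfolding col_alternating_def
proof (intro allI impI)
  fix i j k l :: nat assume ijkl: "i < 3" "j < 3" "k < 3" "l < 3"
  have "(A z i c * A (z + \<eta>) k d) * (B z c j * B (z + \<eta>) d l) = - ((A z i c * A (z + \<eta>) k d) * (B z c l * B (z + \<eta>) d j))"
    if "c < 3" "d < 3" for c d
    using assms(2) that ijkl unfolding col_alternating_def by (metis minus_mult_right)
  then show "mprod A B z i j * mprod A B (z + \<eta>) k l = - (mprod A B z i l * mprod A B (z + \<eta>) k j)"
    using ijkl by (simp add: mprod_mult[OF assms(1)] sum_negf[symmetric])
qed

text \<open>The alternating products of \<open>A\<close> turn the \<open>B\<close> products into
  minors of \<open>B\<close>, and those alternate in their columns by the RTT relation.\<close>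

lemma col_alternating_mprod_left:
  assumes AB: "entries_commute A B" and "col_alternating \<eta> A z" and B: "rtt \<eta> B" "\<eta> \<noteq> 0"
  shows "col_alternating \<eta> (mprod A B) z"
  unfolding col_alternating_def
proof (intro allI impI)
  fix i j k l :: nat assume ijkl: "i < 3" "j < 3" "k < 3" "l < 3"
  have double: "mprod A B z i j * mprod A B (z + \<eta>) k l + mprod A B z i j * mprod A B (z + \<eta>) k l =
      (\<Sum>c<3. \<Sum>d<3. (A z i c * A (z + \<eta>) k d) * minor \<eta> B z c d j l)" if "j < 3" "l < 3" for j l
    unfolding minor_def mprod_mult[OF AB \<open>j < 3\<close> \<open>k < 3\<close>]
    using ijkl assms(2) unfolding col_alternating_def by (intro sum_alternating) blast
  let ?P = "\<lambda>j l. mprod A B z i j * mprod A B (z + \<eta>) k l"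
  have "?P j l + ?P j l = - (?P l j + ?P l j)"
    unfolding double[OF ijkl(2,4)] double[OF ijkl(4,2)] sum_negf[symmetric] minus_mult_right
    using ijkl by (intro sum.cong refl arg_cong2[of _ _ _ _ "(*)"] minor_swap_cols[OF B]) auto
  also have "\<dots> = - ?P l j + - ?P l j" by (rule minus_add_distrib)
  finally show "?P j l = - ?P l j" by (rule endo_double)
qed

section \<open>The quantum determinant and the Lax operator\<close>

lemma alternating3:
  fixes Y :: "nat \<Rightarrow> nat \<Rightarrow> nat \<Rightarrow> 'i endo"
  assumes 1: "\<And>l m n. l < 3 \<Longrightarrow> m < 3 \<Longrightarrow> n < 3 \<Longrightarrow> Y l m n = - Y m l n"
    and 2: "\<And>l m n. l < 3 \<Longrightarrow> m < 3 \<Longrightarrow> n < 3 \<Longrightarrow> Y l m n = - Y l n m"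
  shows "l < 3 \<Longrightarrow> n < 3 \<Longrightarrow> Y l l n = 0" "l < 3 \<Longrightarrow> n < 3 \<Longrightarrow> Y n l l = 0" "l < 3 \<Longrightarrow> n < 3 \<Longrightarrow> Y l n l = 0"
    "Y 1 0 2 = - Y 0 1 2" "Y 0 2 1 = - Y 0 1 2" "Y 2 1 0 = - Y 0 1 2"
    "Y 1 2 0 = Y 0 1 2" "Y 2 0 1 = Y 0 1 2"
proof -
  show a: "Y l l n = 0" if "l < 3" "n < 3" for l n
    using 1[of l l n] that by (intro endo_eq_minus_self) auto
  show "Y n l l = 0" if "l < 3" "n < 3" for l n
    using 2[of n l l] that by (intro endo_eq_minus_self) auto
  show "Y l n l = 0" if "l < 3" "n < 3" for l n
    using 2[of l n l] a[of l n] that by auto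
  show *: "Y 1 0 2 = - Y 0 1 2" "Y 0 2 1 = - Y 0 1 2"
    using 1[of 1 0 2] 2[of 0 2 1] by auto
  show **: "Y 1 2 0 = Y 0 1 2" "Y 2 0 1 = Y 0 1 2"
    using 2[of 1 2 0] 1[of 2 0 1] * by auto
  show "Y 2 1 0 = - Y 0 1 2"
    using 1[of 2 1 0] ** by auto
qed

text \<open>The signed sum over row permutations at three points spaced by \<eta>. The columns are
  left free because multiplicativity of \<open>qdet\<close> passes through all choices of
  them.\<close>

definition qcol :: "complex \<Rightarrow> (complex \<Rightarrow> nat \<Rightarrow> nat \<Rightarrow> 'i endo) \<Rightarrow> complex \<Rightarrow> nat \<Rightarrow> nat \<Rightarrow> nat \<Rightarrow> 'i endo" where
  "qcol \<eta> M z l m n = (let F = (\<lambda>i j k. M z i l * M (z + \<eta>) j m * M (z + \<eta> + \<eta>) k n) in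
     F 0 1 2 - F 1 0 2 + F 1 2 0 - F 2 1 0 + F 2 0 1 - F 0 2 1)"

abbreviation qdet :: "complex \<Rightarrow> (complex \<Rightarrow> nat \<Rightarrow> nat \<Rightarrow> 'i endo) \<Rightarrow> complex \<Rightarrow> 'i endo" where
  "qdet \<eta> M z \<equiv> qcol \<eta> M z 0 1 2"

lemma qcol_minor_left:
  "qcol \<eta> M z l m n = minor \<eta> M z 0 1 l m * M (z + \<eta> + \<eta>) 2 n +
     minor \<eta> M z 1 2 l m * M (z + \<eta> + \<eta>) 0 n + minor \<eta> M z 2 0 l m * M (z + \<eta> + \<eta>) 1 n"
  by (simp add: qcol_def minor_def left_diff_distrib)

lemma qcol_minor_right:
  "qcol \<eta> M z l m n = M z 0 l * minor \<eta> M (z + \<eta>) 1 2 m n +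
     M z 1 l * minor \<eta> M (z + \<eta>) 2 0 m n + M z 2 l * minor \<eta> M (z + \<eta>) 0 1 m n"
  by (simp add: qcol_def minor_def right_diff_distrib mult.assoc)

text \<open>Grouping the first two factors into minors exchanges \<open>l\<close> and
  \<open>m\<close>; grouping the last two exchanges \<open>m\<close> and \<open>n\<close>.\<close>

lemma qcol_swap:
  assumes "rtt \<eta> M" "\<eta> \<noteq> 0" "l < 3" "m < 3" "n < 3"
  shows "qcol \<eta> M z l m n = - qcol \<eta> M z m l n" "qcol \<eta> M z l m n = - qcol \<eta> M z l n m"
proof -
  have s: "minor \<eta> M y i k j j' = - minor \<eta> M y i k j' j" if "i < 3" "k < 3" "j < 3" "j' < 3" for y i k j j'
    using minor_swap_cols[OF assms(1,2)] that by blast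
  show "qcol \<eta> M z l m n = - qcol \<eta> M z m l n"
    unfolding qcol_minor_left
    using s[of 0 1 l m z] s[of 1 2 l m z] s[of 2 0 l m z] assms by simp
  show "qcol \<eta> M z l m n = - qcol \<eta> M z l n m"
    unfolding qcol_minor_right
    using s[of 0 1 m n "z + \<eta>"] s[of 1 2 m n "z + \<eta>"] s[of 2 0 m n "z + \<eta>"] assms by simp
qed

text \<open>Of the 27 intermediate column triples only the six permutations survive, each giving
  \<open>qdet \<eta> A z\<close> with its sign; the signed \<open>B\<close> products add up to
  \<open>qdet \<eta> B z\<close>.\<close>

lemma qdet_mprod:
  assumes A: "rtt \<eta> A" and eta: "\<eta> \<noteq> 0" and AB: "entries_commute A B"
  shows "qdet \<eta> (mprod A B) z = qdet \<eta> A z * qdet \<eta> B z"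
proof -
  have "qdet \<eta> (mprod A B) z = (\<Sum>c<3. \<Sum>d<3. \<Sum>e<3. qcol \<eta> A z c d e *
      (B z c 0 * B (z + \<eta>) d 1 * B (z + \<eta> + \<eta>) e 2))"
    by (simp add: qcol_def Let_def mprod_mult3[OF AB] sum.distrib sum_subtractf
        left_diff_distrib distrib_right)
  also have "\<dots> = qdet \<eta> A z * qdet \<eta> B z"
    unfolding sum3 alternating3[of "qcol \<eta> A z", OF qcol_swap(1)[OF A eta] qcol_swap(2)[OF A eta]]
    by (simp add: alternating3[of "qcol \<eta> A z", OF qcol_swap(1)[OF A eta] qcol_swap(2)[OF A eta], simplified]
       qcol_def[of \<eta> B] Let_def distrib_left right_diff_distrib)
  finally show ?thesis .
qed

text \<open>Both orders of a pair of indices are summed, so this is twice the transfer matrix of the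
  antisymmetric square; \<open>T2\<close> halves it.\<close>

definition trace_minors :: "complex \<Rightarrow> (complex \<Rightarrow> nat \<Rightarrow> nat \<Rightarrow> 'i endo) \<Rightarrow> complex \<Rightarrow> 'i endo" where
  "trace_minors \<eta> M z = (\<Sum>i<3. \<Sum>k<3. minor \<eta> M z i k i k)"

lemma trace_minors_col_alternating:
  assumes "col_alternating \<eta> M z"
  shows "trace_minors \<eta> M z = 2 *\<^sub>c ((\<Sum>i<3. M z i i) * (\<Sum>i<3. M (z + \<eta>) i i))"
proof -
  have "M z k i * M (z + \<eta>) i k = - (M z k k * M (z + \<eta>) i i)" if "i < 3" "k < 3" for i k
    using assms that unfolding col_alternating_def by blast
  then have "trace_minors \<eta> M z = (\<Sum>i<3. \<Sum>k<3. M z i i * M (z + \<eta>) k k) + (\<Sum>i<3. \<Sum>k<3. M z k k * M (z + \<eta>) i i)"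
    unfolding trace_minors_def minor_def by (simp add: sum.distrib)
  also have "(\<Sum>i<3. \<Sum>k<3. M z k k * M (z + \<eta>) i i) = (\<Sum>k<3. \<Sum>i<3. M z k k * M (z + \<eta>) i i)"
    by (rule sum.swap)
  finally show ?thesis
    unfolding sum_product by (intro endo_eqI) simp
qed

text \<open>\<open>X\<close> alternates in its first two columns because minors do, and in its last
  two by the hypothesis at \<open>z + \<eta>\<close>. So only permuted triples remain, all reducible
  to columns 0, 1, 2; antisymmetry in the first two rows then pairs them into twice the expansion of
  \<open>qdet\<close> along its last factor.\<close>

lemma trace_minors_qdet:
  assumes M: "rtt \<eta> M" and eta: "\<eta> \<noteq> 0" and col: "col_alternating \<eta> M (z + \<eta>)"
  shows "trace_minors \<eta> M z * (\<Sum>i<3. M (z + \<eta> + \<eta>) i i) = 2 *\<^sub>c qdet \<eta> M z"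
proof -
  define X where "X i j k l m n = minor \<eta> M z i j l m * M (z + \<eta> + \<eta>) k n" for i j k l m n
  have 1: "X i j k l m n = - X i j k m l n"
    if "i < 3" "j < 3" "l < 3" "m < 3" for i j k l m n
    unfolding X_def using minor_swap_cols[OF M eta that(1,3,2,4), of z] by simp
  have 2: "X i j k l m n = - X i j k l n m"
    if "i < 3" "j < 3" "k < 3" "m < 3" "n < 3" for i j k l m n
  proof -
    have "M (z + \<eta>) j m * M (z + \<eta> + \<eta>) k n = - (M (z + \<eta>) j n * M (z + \<eta> + \<eta>) k m)"
      "M (z + \<eta>) i m * M (z + \<eta> + \<eta>) k n = - (M (z + \<eta>) i n * M (z + \<eta> + \<eta>) k m)"
      using col that unfolding col_alternating_def by blast+
    then show ?thesis
      unfolding X_def minor_def by (simp add: left_diff_distrib mult.assoc)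
  qed
  note alt = alternating3[of "X i j k" for i j k, OF 1 2]
  have rows: "X i j k l m n = - X j i k l m n" for i j k l m n
    by (simp add: X_def minor_def left_diff_distrib)
  then have rows0: "X i i k l m n = 0" for i k l m n
    by (intro endo_eq_minus_self)
  have "trace_minors \<eta> M z * (\<Sum>i<3. M (z + \<eta> + \<eta>) i i) = (\<Sum>i<3. \<Sum>j<3. \<Sum>k<3. X i j k i j k)"
    unfolding trace_minors_def X_def by (simp only: sum_distrib_right) (simp only: sum_distrib_left)
  also have "\<dots> = X 0 1 2 0 1 2 + X 0 2 1 0 2 1 + X 1 0 2 1 0 2 + X 1 2 0 1 2 0 + X 2 0 1 2 0 1 + X 2 1 0 2 1 0"
    unfolding sum3 using alt(1-3) by (simp add: rows0)
  also have "\<dots> = X 0 1 2 0 1 2 - X 0 2 1 0 1 2 - X 1 0 2 0 1 2 + X 1 2 0 0 1 2 + X 2 0 1 0 1 2 - X 2 1 0 0 1 2"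
    using alt(4-8)[of 0 2 1] alt(4-8)[of 1 0 2] alt(4-8)[of 1 2 0] alt(4-8)[of 2 0 1] alt(4-8)[of 2 1 0]
    by simp
  also have "\<dots> = 2 *\<^sub>c (X 0 1 2 0 1 2 + X 1 2 0 0 1 2 + X 2 0 1 0 1 2)"
    unfolding rows[of 0 2 1] rows[of 1 0 2] rows[of 2 1 0]
    by (rule endo_eqI) simp
  also have "X 0 1 2 0 1 2 + X 1 2 0 0 1 2 + X 2 0 1 0 1 2 = qdet \<eta> M z"
    by (simp add: X_def qcol_minor_left)
  finally show ?thesis .
qed

text \<open>The entries of \<open>R\<close> in the auxiliary space. The unit is
  \<open>E j i\<close>, with transposed indices, because the permutation is the sum of e_ij tensor
  e_ji.\<close>

definition lax :: "complex \<Rightarrow> (nat \<Rightarrow> nat \<Rightarrow> 'i endo) \<Rightarrow> complex \<Rightarrow> complex \<Rightarrow> nat \<Rightarrow> nat \<Rightarrow> 'i endo" where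
  "lax \<eta> E x z i j = (if i = j then (z - x) *\<^sub>c 1 else 0) + \<eta> *\<^sub>c E j i"

definition matrix_units :: "(nat \<Rightarrow> nat \<Rightarrow> 'i endo) \<Rightarrow> bool" where
  "matrix_units E \<longleftrightarrow> (\<forall>i<3. \<forall>j<3. \<forall>k<3. \<forall>l<3. E i j * E k l = (if j = k then E i l else 0)) \<and>
     (\<Sum>i<3. E i i) = 1"

lemma matrix_units_mult:
  "matrix_units E \<Longrightarrow> i < 3 \<Longrightarrow> j < 3 \<Longrightarrow> k < 3 \<Longrightarrow> l < 3 \<Longrightarrow> E i j * E k l = (if j = k then E i l else 0)"
  by (simp add: matrix_units_def)

lemma rtt_lax:
  assumes "matrix_units E"
  shows "rtt \<eta> (lax \<eta> E x)"
  unfolding rtt_def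
proof (intro allI impI)
  fix z w and i j k l :: nat assume "i < 3" "j < 3" "k < 3" "l < 3"
  note E = matrix_units_mult[OF assms]
  show "(z - w) *\<^sub>c (lax \<eta> E x z i j * lax \<eta> E x w k l) + \<eta> *\<^sub>c (lax \<eta> E x z k j * lax \<eta> E x w i l) =
     (z - w) *\<^sub>c (lax \<eta> E x w k l * lax \<eta> E x z i j) + \<eta> *\<^sub>c (lax \<eta> E x w k j * lax \<eta> E x z i l)"
    using \<open>i < 3\<close> \<open>j < 3\<close> \<open>k < 3\<close> \<open>l < 3\<close>
    by (intro endo_eqI, cases "i = j"; cases "k = l"; cases "k = j"; cases "i = l")
       (simp_all add: lax_def distrib_left distrib_right E del: app_simps(6), simp_all add: algebra_simps)
qed

text \<open>At \<open>z = x\<close> the first factor is purely the permutation part, and the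
  Kronecker terms of the shifted factor cancel against the products of matrix units.\<close>

lemma minor_lax_zero:
  assumes "matrix_units E" "i < 3" "j < 3" "k < 3" "l < 3"
  shows "minor \<eta> (lax \<eta> E x) x i k j l = 0"
proof -
  note E = matrix_units_mult[OF assms(1)]
  show ?thesis
    using assms(2-)
    by (intro endo_eqI, cases "k = l"; cases "i = l")
       (simp_all add: minor_def lax_def distrib_left distrib_right E del: app_simps(6))
qed

text \<open>The second factor sits at \<open>x\<close>, where it is \<eta> times
  \<open>E l k\<close>. The product is \<eta>^2 times (\<delta>_il \<open>E j k\<close> -
  \<delta>_ij \<open>E l k\<close>), which is alternating in \<open>j\<close> and
  \<open>l\<close>.\<close>

lemma col_alternating_lax:
  assumes "matrix_units E"
  shows "col_alternating \<eta> (lax \<eta> E x) (x - \<eta>)"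
  unfolding col_alternating_def
proof (intro allI impI)
  fix i j k l :: nat assume "i < 3" "j < 3" "k < 3" "l < 3"
  note E = matrix_units_mult[OF assms(1)]
  show "lax \<eta> E x (x - \<eta>) i j * lax \<eta> E x (x - \<eta> + \<eta>) k l = - (lax \<eta> E x (x - \<eta>) i l * lax \<eta> E x (x - \<eta> + \<eta>) k j)"
    using \<open>i < 3\<close> \<open>j < 3\<close> \<open>k < 3\<close> \<open>l < 3\<close>
    by (intro endo_eqI, cases "i = j"; cases "i = l")
       (simp_all add: lax_def distrib_left distrib_right left_diff_distrib E del: app_simps(6))
qed

lemma qdet_lax:
  assumes "matrix_units E"
  shows "qdet \<eta> (lax \<eta> E x) z = ((z - x) * (z - x + \<eta>) * (z - x + 3 * \<eta>)) *\<^sub>c 1"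
proof (rule endo_eqI)
  fix f p
  note E = matrix_units_mult[OF assms(1)]
  \<comment> \<open>Completeness of the diagonal units is what makes the quantum determinant a
    scalar.\<close>
  have "E 0 0 + E 1 1 + E 2 2 = 1"
    using assms by (simp add: matrix_units_def sum3)
  then have "app (E 0 0 + E 1 1 + E 2 2) f p = app 1 f p" by simp
  then have f: "f p = app (E 0 0) f p + app (E 1 1) f p + app (E 2 2) f p" by simp
  show "app (qdet \<eta> (lax \<eta> E x) z) f p = app (((z - x) * (z - x + \<eta>) * (z - x + 3 * \<eta>)) *\<^sub>c 1) f p"
    by (simp add: qcol_def Let_def lax_def distrib_left distrib_right E del: app_simps(6))
       (simp add: f algebra_simps)
qed

section \<open>Operator-valued polynomials and interpolation\<close>

text \<open>\<open>opoly d F c\<close>: in Horner form, \<open>F\<close> is a polynomial of degree at most \<open>d\<close> whose coefficient of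
\<open>z ^ d\<close> is \<open>c\<close>, possibly zero.\<close>

fun opoly :: "nat \<Rightarrow> (complex \<Rightarrow> 'i endo) \<Rightarrow> 'i endo \<Rightarrow> bool" where
  "opoly 0 F c \<longleftrightarrow> (\<forall>z. F z = c)"
| "opoly (Suc d) F c \<longleftrightarrow> (\<exists>G C. opoly d G c \<and> (\<forall>z. F z = z *\<^sub>c G z + C))"

lemma opoly_add: "opoly d F a \<Longrightarrow> opoly d G b \<Longrightarrow> opoly d (\<lambda>z. F z + G z) (a + b)"
proof (induction d arbitrary: F G)
  case (Suc d)
  then obtain F' C G' D where "opoly d F' a" "opoly d G' b"
    "\<And>z. F z = z *\<^sub>c F' z + C" "\<And>z. G z = z *\<^sub>c G' z + D" by auto
  then show ?case
    using Suc.IH[of F' G']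
    by (auto intro!: exI[of _ "\<lambda>z. F' z + G' z"] exI[of _ "C + D"] simp: endo.scale_right_distrib)
qed auto

lemma opoly_mult_left: "opoly d F a \<Longrightarrow> opoly d (\<lambda>z. A * F z) (A * a)"
proof (induction d arbitrary: F)
  case (Suc d)
  then obtain F' C where "opoly d F' a" "\<And>z. F z = z *\<^sub>c F' z + C" by auto
  then show ?case
    using Suc.IH[of F']
    by (auto intro!: exI[of _ "\<lambda>z. A * F' z"] exI[of _ "A * C"] simp: distrib_left)
qed auto

lemma opoly_scale: "opoly d F a \<Longrightarrow> opoly d (\<lambda>z. c *\<^sub>c F z) (c *\<^sub>c a)"
  using opoly_mult_left[of d F a "c *\<^sub>c 1"] by simp

lemma opoly_diff: "opoly d F a \<Longrightarrow> opoly d G b \<Longrightarrow> opoly d (\<lambda>z. F z - G z) (a - b)"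
  using opoly_add[OF _ opoly_mult_left[of d G b "-1"], of F a] by simp

lemma opoly_zero: "opoly d (\<lambda>z. 0) 0"
  by (induction d) (auto intro!: exI[of _ "\<lambda>z. 0"])

lemma opoly_sum:
  "(\<And>i. i \<in> I \<Longrightarrow> opoly d (F i) (a i)) \<Longrightarrow> opoly d (\<lambda>z. \<Sum>i\<in>I. F i z) (\<Sum>i\<in>I. a i)"
  by (induction I rule: infinite_finite_induct) (auto intro: opoly_add opoly_zero)

lemma opoly_Suc: "opoly d F a \<Longrightarrow> opoly (Suc d) F 0"
proof (induction d arbitrary: F)
  case 0
  then show ?case by (auto intro!: exI[of _ "\<lambda>z. 0"])
next
  case (Suc d)
  then obtain F' C where "opoly d F' a" "\<And>z. F z = z *\<^sub>c F' z + C" by auto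
  with Suc.IH[of F'] show ?case by (subst opoly.simps) blast
qed

lemma opoly_less: "opoly d F a \<Longrightarrow> d < e \<Longrightarrow> opoly e F 0"
  by (induction e arbitrary: a) (metis less_Suc_eq not_less_zero opoly_Suc)+

lemma opoly_mult: "opoly d F a \<Longrightarrow> opoly e G b \<Longrightarrow> opoly (d + e) (\<lambda>z. F z * G z) (a * b)"
proof (induction d arbitrary: F)
  case 0
  then show ?case using opoly_mult_left[of e G b a] by simp
next
  case (Suc d)
  then obtain F' C where F': "opoly d F' a" "\<And>z. F z = z *\<^sub>c F' z + C" by auto
  have "opoly (Suc (d + e)) (\<lambda>z. z *\<^sub>c (F' z * G z)) (a * b)"
    using Suc.IH[OF F'(1) Suc.prems(2)] by (auto intro!: exI[of _ "\<lambda>z. F' z * G z"])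
  moreover have "opoly (Suc (d + e)) (\<lambda>z. C * G z) 0"
    using opoly_less[OF opoly_mult_left[OF Suc.prems(2)], of "Suc (d + e)"] by simp
  ultimately have "opoly (Suc (d + e)) (\<lambda>z. z *\<^sub>c (F' z * G z) + C * G z) (a * b + 0)"
    by (rule opoly_add)
  then show ?case by (simp add: F'(2) distrib_right)
qed

lemma opoly_scalar: "degree q \<le> d \<Longrightarrow> opoly d (\<lambda>z. poly q z *\<^sub>c A) (coeff q d *\<^sub>c A)"
proof (induction d arbitrary: q)
  case 0
  then show ?case by (auto elim!: degree_eq_zeroE)
next
  case (Suc d)
  obtain a q' where q: "q = pCons a q'" by (rule pCons_cases)
  with Suc.prems have "degree q' \<le> d" by (auto split: if_splits)
  from Suc.IH[OF this] show ?case
    by (auto intro!: exI[of _ "\<lambda>z. poly q' z *\<^sub>c A"] exI[of _ "a *\<^sub>c A"]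
        simp: q endo.scale_left_distrib add.commute)
qed

lemma opoly_app:
  "opoly d F a \<Longrightarrow> \<exists>q. degree q \<le> d \<and> coeff q d = app a f p \<and> (\<forall>z. poly q z = app (F z) f p)"
proof (induction d arbitrary: F)
  case 0
  then show ?case by (intro exI[of _ "[:app a f p:]"]) auto
next
  case (Suc d)
  then obtain G C where G: "opoly d G a" "\<And>z. F z = z *\<^sub>c G z + C" by auto
  from Suc.IH[OF G(1)] obtain q where "degree q \<le> d" "coeff q d = app a f p" "\<And>z. poly q z = app (G z) f p"
    by auto
  with G(2) show ?case
    by (intro exI[of _ "pCons (app C f p) q"]) (auto simp: degree_pCons_eq_if)
qed

lemma poly_eq_0_if_many_roots:
  fixes q :: "'a::idom poly"
  assumes "degree q \<le> d" "coeff q d = 0" "finite Z" "card Z = d" "\<And>z. z \<in> Z \<Longrightarrow> poly q z = 0"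
  shows "q = 0"
proof (rule ccontr)
  assume "q \<noteq> 0"
  then have "degree q < d"
    using assms(1,2) by (metis le_neq_implies_less leading_coeff_0_iff)
  moreover have "card Z \<le> card {z. poly q z = 0}"
    using assms(5) \<open>q \<noteq> 0\<close> by (intro card_mono poly_roots_finite) auto
  moreover have "card {z. poly q z = 0} \<le> degree q"
    using \<open>q \<noteq> 0\<close> by (rule card_poly_roots_bound)
  ultimately show False using assms(4) by simp
qed

text \<open>The common coefficient of z^d cancels in the difference, so \<open>d\<close> nodes
  decide instead of \<open>d + 1\<close>. The count of roots is done for each matrix element
  separately.\<close>

lemma opoly_eqI:
  assumes "opoly d F a" "opoly d G a" "finite Z" "card Z = d" "\<And>z. z \<in> Z \<Longrightarrow> F z = G z"
  shows "F z = G z"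
proof (rule endo_eqI)
  fix f p
  have "opoly d (\<lambda>z. F z - G z) 0" using opoly_diff[OF assms(1,2)] by simp
  from opoly_app[OF this, of f p] obtain q where
    q: "degree q \<le> d" "coeff q d = 0" "\<And>z. poly q z = app (F z - G z) f p" by auto
  have "q = 0"
    using q assms(3-) by (intro poly_eq_0_if_many_roots[of q d Z]) auto
  with q(3)[of z] show "app (F z) f p = app (G z) f p" by simp
qed

lemma degree_prod_linear:
  fixes A :: "'b set" and u v :: "'b \<Rightarrow> 'a::idom"
  assumes "finite A"
  shows "degree (\<Prod>b\<in>A. [:u b, v b:]) \<le> card A"
proof -
  have "degree (\<Prod>b\<in>A. [:u b, v b:]) \<le> (\<Sum>b\<in>A. degree [:u b, v b:])"
    using degree_prod_sum_le[OF assms, of "\<lambda>b. [:u b, v b:]"] by (simp only: comp_def)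
  also have "\<dots> \<le> (\<Sum>b\<in>A. 1)" by (intro sum_mono) auto
  finally show ?thesis by simp
qed

lemma degree_prod_monic_linear:
  fixes A :: "'b set" and u :: "'b \<Rightarrow> 'a::idom"
  assumes "finite A"
  shows "degree (\<Prod>b\<in>A. [:u b, 1:]) = card A" "coeff (\<Prod>b\<in>A. [:u b, 1:]) (card A) = 1"
proof -
  show *: "degree (\<Prod>b\<in>A. [:u b, 1:]) = card A"
    by (subst degree_prod_eq_sum_degree) auto
  show "coeff (\<Prod>b\<in>A. [:u b, 1:]) (card A) = 1"
    using lead_coeff_prod[of "\<lambda>b. [:u b, 1:]" A] by (simp add: *)
qed

section \<open>Interpolation polynomials and their values at the nodes\<close>

definition g_poly :: "nat \<Rightarrow> (nat \<Rightarrow> complex) \<Rightarrow> nat \<Rightarrow> complex poly" where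
  "g_poly N \<xi> a = (\<Prod>b \<in> {1..N} - {a}. [:- \<xi> b / (\<xi> a - \<xi> b), 1 / (\<xi> a - \<xi> b):])"

definition f_poly :: "nat \<Rightarrow> complex \<Rightarrow> (nat \<Rightarrow> complex) \<Rightarrow> nat \<Rightarrow> complex poly" where
  "f_poly N \<eta> \<xi> a = (\<Prod>b \<in> {1..N} - {a}. [:(\<eta> - \<xi> b) / (\<xi> a - \<xi> b), 1 / (\<xi> a - \<xi> b):]) *
     (\<Prod>b \<in> {1..N}. [:- \<xi> b / (\<xi> a - \<eta> - \<xi> b), 1 / (\<xi> a - \<eta> - \<xi> b):])"

lemma poly_g_poly: "poly (g_poly N \<xi> a) z = g_fun N \<xi> a z"
  unfolding g_poly_def g_fun_def poly_prod
  by (intro prod.cong refl) (simp add: diff_divide_distrib)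

lemma poly_f_poly: "poly (f_poly N \<eta> \<xi> a) z = f_fun N \<eta> \<xi> a z"
  unfolding f_poly_def f_fun_def poly_prod poly_mult
  by (intro arg_cong2[of _ _ _ _ "(*)"] prod.cong refl)
     (simp_all add: diff_divide_distrib add_divide_distrib)

lemma degree_g_poly: "a \<in> {1..N} \<Longrightarrow> degree (g_poly N \<xi> a) < N"
  unfolding g_poly_def
  by (rule le_less_trans[OF degree_prod_linear]) auto

lemma degree_f_poly: "a \<in> {1..N} \<Longrightarrow> degree (f_poly N \<eta> \<xi> a) < 2 * N"
proof -
  assume a: "a \<in> {1..N}"
  have "degree (f_poly N \<eta> \<xi> a) \<le> card ({1..N} - {a}) + card {1..N}"
    unfolding f_poly_def by (intro order_trans[OF degree_mult_le] add_mono degree_prod_linear) auto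
  with a show ?thesis by auto
qed

lemma g_fun_node:
  assumes "inj_on \<xi> {1..N}" "a \<in> {1..N}" "b \<in> {1..N}"
  shows "g_fun N \<xi> a (\<xi> b) = (if a = b then 1 else 0)"
proof (cases "a = b")
  case True
  have "(\<xi> a - \<xi> c) / (\<xi> a - \<xi> c) = 1" if "c \<in> {1..N} - {a}" for c
    using inj_onD[OF assms(1), of a c] that assms by auto
  then show ?thesis using True unfolding g_fun_def by (simp add: prod.neutral)
next
  case False
  then have "b \<in> {1..N} - {a}" using assms by auto
  then show ?thesis using False unfolding g_fun_def by (auto intro!: prod_zero)
qed

text \<open>After the shift by -\<eta> the first product of \<open>f_fun\<close> is
  \<open>g_fun\<close> at \<xi> b, and the second is 1 if a = b. Without the shift the second
  product has a zero factor.\<close>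

lemma f_fun_node:
  assumes "inj_on \<xi> {1..N}" "a \<in> {1..N}" "b \<in> {1..N}" "\<And>c. c \<in> {1..N} \<Longrightarrow> \<xi> a - \<eta> \<noteq> \<xi> c"
  shows "f_fun N \<eta> \<xi> a (\<xi> b - \<eta>) = (if a = b then 1 else 0)" "f_fun N \<eta> \<xi> a (\<xi> b) = 0"
proof -
  have "f_fun N \<eta> \<xi> a (\<xi> b - \<eta>) = g_fun N \<xi> a (\<xi> b) * (\<Prod>c \<in> {1..N}. (\<xi> b - \<eta> - \<xi> c) / (\<xi> a - \<eta> - \<xi> c))"
    unfolding f_fun_def g_fun_def by simp
  also have "\<dots> = (if a = b then 1 else 0)"
    using assms(4) by (auto simp: g_fun_node[OF assms(1-3)] intro!: prod.neutral)
  finally show "f_fun N \<eta> \<xi> a (\<xi> b - \<eta>) = (if a = b then 1 else 0)" .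
  show "f_fun N \<eta> \<xi> a (\<xi> b) = 0"
    using assms(3) by (auto simp: f_fun_def)
qed

section \<open>The inhomogeneous chain\<close>

text \<open>The six terms are listed in the order of \<open>qcol\<close>, for comparison with the
  quantum determinant of the twist.\<close>

lemma det_3:
  assumes A: "(A :: complex mat) \<in> carrier_mat 3 3"
  shows "det A = A $$ (0,0) * A $$ (1,1) * A $$ (2,2) - A $$ (1,0) * A $$ (0,1) * A $$ (2,2)
    + A $$ (1,0) * A $$ (2,1) * A $$ (0,2) - A $$ (2,0) * A $$ (1,1) * A $$ (0,2)
    + A $$ (2,0) * A $$ (0,1) * A $$ (1,2) - A $$ (0,0) * A $$ (2,1) * A $$ (1,2)"
proof -
  have 1: "det B = B $$ (0,0)" if "B \<in> carrier_mat 1 1" for B :: "complex mat"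
    using that by (simp add: det_single)
  have 2: "det B = B $$ (0,0) * B $$ (1,1) - B $$ (0,1) * B $$ (1,0)" if B: "B \<in> carrier_mat 2 2" for B :: "complex mat"
    using B by (subst laplace_expansion_row[OF B, of 0])
      (auto simp: cofactor_def eval_nat_numeral 1 mat_delete_def)
  show ?thesis
    using A by (subst laplace_expansion_row[OF A, of 0])
      (auto simp: sum3 cofactor_def 2 mat_delete_def numeral_2_eq_2 algebra_simps)
qed

text \<open>The algebra uses only the matrix unit relations and the commutation of different sites;
  the ternary encoding of states enters with \<open>site_unit\<close>.\<close>

locale spin_chain =
  fixes E :: "nat \<Rightarrow> nat \<Rightarrow> nat \<Rightarrow> 'i endo" and \<eta> :: complex and \<xi> :: "nat \<Rightarrow> complex"
    and K :: "complex mat" and N :: nat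
  assumes units: "matrix_units (E n)"
    and E_commute: "\<lbrakk>m \<noteq> n; i < 3; j < 3; k < 3; l < 3\<rbrakk> \<Longrightarrow> E m i j * E n k l = E n k l * E m i j"
    and K: "K \<in> carrier_mat 3 3"
begin

text \<open>Site \<open>n \<in> {1..N}\<close> carries the matrix units \<open>E (n - 1)\<close> and the inhomogeneity \<open>\<xi> n\<close>.\<close>

abbreviation L :: "nat \<Rightarrow> complex \<Rightarrow> nat \<Rightarrow> nat \<Rightarrow> 'i endo" where
  "L n \<equiv> lax \<eta> (E n) (\<xi> (Suc n))"

primrec chain :: "nat \<Rightarrow> complex \<Rightarrow> nat \<Rightarrow> nat \<Rightarrow> 'i endo" where
  "chain 0 = (\<lambda>z i j. if i = j then 1 else 0)"
| "chain (Suc m) = mprod (L m) (chain m)"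

definition twist :: "complex \<Rightarrow> nat \<Rightarrow> nat \<Rightarrow> 'i endo" where
  "twist z i j = K $$ (i, j) *\<^sub>c 1"

definition M :: "complex \<Rightarrow> nat \<Rightarrow> nat \<Rightarrow> 'i endo" where
  "M = mprod twist (chain N)"

definition T :: "complex \<Rightarrow> 'i endo" where
  "T z = (\<Sum>i<3. M z i i)"

definition T2 :: "complex \<Rightarrow> 'i endo" where
  "T2 z = (1 / 2) *\<^sub>c trace_minors \<eta> M z"

lemma entries_commute_L_chain: "m \<le> n \<Longrightarrow> entries_commute (L n) (chain m)"
proof (induction m)
  case 0
  then show ?case by (auto simp: entries_commute_def)
next
  case (Suc m)
  then have IH: "entries_commute (L n) (chain m)" and "n \<noteq> m" by auto
  have LL: "L n z i j * L m w k l = L m w k l * L n z i j"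
    if "i < 3" "j < 3" "k < 3" "l < 3" for z w i j k l
    using E_commute[OF \<open>n \<noteq> m\<close>] that by (simp add: lax_def distrib_left distrib_right endo.scale_right_distrib mult.commute)
  show ?case
    unfolding entries_commute_def chain.simps mprod_def sum_distrib_left sum_distrib_right
  proof (intro allI impI sum.cong refl)
    fix z w and i j k l c :: nat
    assume *: "i < 3" "j < 3" "k < 3" "l < 3" "c \<in> {..<3}"
    then have "L n z i j * chain m w c l = chain m w c l * L n z i j"
      using IH by (auto simp: entries_commute_def)
    with LL[of i j k c z w] * show "L n z i j * (L m w k c * chain m w c l) = L m w k c * chain m w c l * L n z i j"
      by (metis lessThan_iff mult.assoc)
  qed
qed

lemma entries_commute_twist: "entries_commute twist A"
  by (auto simp: entries_commute_def twist_def)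

lemma rtt_chain: "rtt \<eta> (chain m)"
proof (induction m)
  case 0
  show ?case by (auto simp: rtt_def)
next
  case (Suc m)
  then show ?case
    using rtt_mprod[OF rtt_lax[OF units] Suc.IH entries_commute_L_chain] by simp
qed

lemma rtt_twist: "rtt \<eta> twist"
  by (auto simp: rtt_def twist_def mult.commute)

lemma rtt_M: "rtt \<eta> M"
  unfolding M_def by (intro rtt_mprod rtt_twist rtt_chain entries_commute_twist)

lemma T_commute: "(z - w)\<^sup>2 \<noteq> \<eta>\<^sup>2 \<Longrightarrow> T z * T w = T w * T z"
  unfolding T_def by (rule rtt_trace_commute[OF rtt_M])

lemma chain_eta_zero:
  "\<eta> = 0 \<Longrightarrow> i < 3 \<Longrightarrow> chain m z i j = (if i = j then (\<Prod>a\<in>{1..m}. z - \<xi> a) *\<^sub>c 1 else 0)"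
proof (induction m arbitrary: i)
  case 0
  show ?case by simp
next
  case (Suc m)
  have "chain (Suc m) z i j = (\<Sum>c<3. (if c = i then (z - \<xi> (Suc m)) *\<^sub>c chain m z i j else 0))"
    unfolding chain.simps mprod_def using Suc.prems by (intro sum.cong refl) (auto simp: lax_def)
  also have "\<dots> = (z - \<xi> (Suc m)) *\<^sub>c chain m z i j"
    using Suc.prems by (subst sum.delta) auto
  also have "\<dots> = (if i = j then (\<Prod>a\<in>{1..Suc m}. z - \<xi> a) *\<^sub>c 1 else 0)"
    using Suc by (simp add: mult.commute)
  finally show ?case .
qed

lemma T_eta_zero: "\<eta> = 0 \<Longrightarrow> n \<in> {1..N} \<Longrightarrow> T (\<xi> n) = 0"
proof -
  assume "\<eta> = 0" "n \<in> {1..N}"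
  then have "chain N (\<xi> n) i j = 0" if "i < 3" for i j
    unfolding chain_eta_zero[OF \<open>\<eta> = 0\<close> that] by auto
  then show ?thesis by (simp add: T_def M_def mprod_def)
qed

text \<open>Site \<open>n\<close> has the property by \<open>col_alternating_lax\<close>. Sites
  below it are absorbed as right factors, sites above it as left factors.\<close>

lemma col_alternating_chain:
  assumes "\<eta> \<noteq> 0" "n \<in> {1..m}"
  shows "col_alternating \<eta> (chain m) (\<xi> n - \<eta>)"
  using assms(2)
proof (induction m)
  case (Suc m)
  show ?case
  proof (cases "n = Suc m")
    case True
    then show ?thesis
      using col_alternating_mprod_left[OF entries_commute_L_chain col_alternating_lax[OF units] rtt_chain assms(1)]
      by simp
  next
    case False
    with Suc show ?thesis
      using col_alternating_mprod_right[OF entries_commute_L_chain] by simp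
  qed
qed auto

lemma col_alternating_M: "\<eta> \<noteq> 0 \<Longrightarrow> n \<in> {1..N} \<Longrightarrow> col_alternating \<eta> M (\<xi> n - \<eta>)"
  unfolding M_def by (intro col_alternating_mprod_right entries_commute_twist col_alternating_chain)

lemma minor_chain_zero:
  assumes "\<eta> \<noteq> 0" "n \<in> {1..m}" "i < 3" "j < 3" "k < 3" "l < 3"
  shows "minor \<eta> (chain m) (\<xi> n) i k j l = 0"
  using assms(2-)
proof (induction m arbitrary: i j k l)
  case (Suc m)
  show ?case
  proof (cases "n = Suc m")
    case True
    show ?thesis
      unfolding chain.simps True
      by (intro minor_mprod_left_zero entries_commute_L_chain minor_lax_zero units Suc.prems) auto
  next
    case False
    with Suc.prems have n: "n \<in> {1..m}" by auto
    show ?thesis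
      unfolding chain.simps
      by (intro minor_mprod_right_zero rtt_lax units assms(1) entries_commute_L_chain Suc.prems Suc.IH n) auto
  qed
qed auto

lemma T2_zero: "\<eta> \<noteq> 0 \<Longrightarrow> n \<in> {1..N} \<Longrightarrow> T2 (\<xi> n) = 0"
  unfolding T2_def trace_minors_def M_def
  by (subst sum.neutral) (auto intro!: sum.neutral minor_mprod_right_zero rtt_twist
      entries_commute_twist minor_chain_zero)

lemma T2_fusion:
  assumes "\<eta> \<noteq> 0" "n \<in> {1..N}"
  shows "T2 (\<xi> n - \<eta>) = T (\<xi> n - \<eta>) * T (\<xi> n)"
  unfolding T2_def T_def trace_minors_col_alternating[OF col_alternating_M[OF assms]]
  by simp

lemma qdet_chain:
  assumes "\<eta> \<noteq> 0"
  shows "qdet \<eta> (chain m) z =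
    (\<Prod>b\<in>{1..m}. (z - \<xi> b) * (z + \<eta> - \<xi> b) * (z + 3 * \<eta> - \<xi> b)) *\<^sub>c 1"
proof (induction m)
  case 0
  then show ?case by (simp add: qcol_def)
next
  case (Suc m)
  show ?case
    unfolding chain.simps qdet_lax[OF units] Suc.IH
      qdet_mprod[OF rtt_lax[OF units] assms entries_commute_L_chain[OF order.refl]]
    by (simp add: diff_add_eq mult_ac)
qed

lemma qdet_M: "\<eta> \<noteq> 0 \<Longrightarrow> qdet \<eta> M z = q_det N \<eta> \<xi> K z *\<^sub>c 1"
proof -
  assume "\<eta> \<noteq> 0"
  have "qdet \<eta> twist z = det K *\<^sub>c 1"
    by (rule endo_eqI) (simp add: qcol_def twist_def det_3[OF K] algebra_simps)
  with \<open>\<eta> \<noteq> 0\<close> show ?thesis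
    unfolding M_def q_det_def qdet_mprod[OF rtt_twist \<open>\<eta> \<noteq> 0\<close> entries_commute_twist] qdet_chain[OF \<open>\<eta> \<noteq> 0\<close>]
    by simp
qed

text \<open>The three factors sit at \<xi> n - 2\<eta>, \<xi> n - \<eta> and \<xi> n, and the
  columns of the last two alternate. The 2 from \<open>trace_minors_qdet\<close> cancels the 1/2 in
  \<open>T2\<close>.\<close>

lemma T2_mult_T:
  assumes "\<eta> \<noteq> 0" "n \<in> {1..N}"
  shows "T2 (\<xi> n - 2 * \<eta>) * T (\<xi> n) = q_det N \<eta> \<xi> K (\<xi> n - 2 * \<eta>) *\<^sub>c 1"
proof -
  let ?z = "\<xi> n - 2 * \<eta>"
  have "col_alternating \<eta> M (?z + \<eta>)"
    using col_alternating_M[OF assms] by (simp add: algebra_simps)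
  from trace_minors_qdet[OF rtt_M assms(1) this]
  have "trace_minors \<eta> M ?z * (\<Sum>i<3. M (?z + \<eta> + \<eta>) i i) = 2 *\<^sub>c qdet \<eta> M ?z" .
  moreover have "?z + \<eta> + \<eta> = \<xi> n" by simp
  ultimately show ?thesis
    unfolding T2_def T_def qdet_M[OF assms(1)] by simp
qed

section \<open>Degrees and leading coefficients, uniformly in a shift \<open>c\<close> of the
  spectral parameter\<close>

lemma opoly_L: "opoly 1 (\<lambda>z. L n (z + c) i j) (if i = j then 1 else 0)"
  by (auto simp: lax_def intro!: exI[of _ "\<lambda>z. if i = j then 1 else 0"]
      exI[of _ "(if i = j then (c - \<xi> (Suc n)) *\<^sub>c 1 else 0) + \<eta> *\<^sub>c E n j i"] endo_eqI simp: algebra_simps)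

lemma opoly_chain: "i < 3 \<Longrightarrow> opoly m (\<lambda>z. chain m (z + c) i j) (if i = j then 1 else 0)"
proof (induction m arbitrary: i)
  case (Suc m)
  have "opoly (1 + m) (\<lambda>z. \<Sum>k<3. L m (z + c) i k * chain m (z + c) k j)
      (\<Sum>k<3. (if i = k then 1 else 0) * (if k = j then 1 else 0))"
    using Suc by (intro opoly_sum opoly_mult opoly_L) auto
  also have "(\<Sum>k<3. (if i = k then 1 else 0) * (if k = j then 1 else 0)) = (\<Sum>k<3. if k = i then (if i = j then 1 else 0) else (0 :: 'i endo))"
    by (intro sum.cong) auto
  also have "\<dots> = (if i = j then 1 else 0)"
    using Suc.prems by (subst sum.delta) auto
  finally show ?case by (simp add: mprod_def)
qed auto

lemma opoly_M: "j < 3 \<Longrightarrow> opoly N (\<lambda>z. M (z + c) i j) (K $$ (i, j) *\<^sub>c 1)"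
proof -
  assume "j < 3"
  have "opoly N (\<lambda>z. \<Sum>k<3. K $$ (i, k) *\<^sub>c chain N (z + c) k j)
      (\<Sum>k<3. K $$ (i, k) *\<^sub>c (if k = j then 1 else 0))"
    by (intro opoly_sum opoly_scale opoly_chain) auto
  also have "(\<Sum>k<3. K $$ (i, k) *\<^sub>c (if k = j then 1 else 0)) = (\<Sum>k<3. if k = j then K $$ (i, j) *\<^sub>c 1 else (0 :: 'i endo))"
    by (intro sum.cong) auto
  also have "\<dots> = K $$ (i, j) *\<^sub>c 1"
    using \<open>j < 3\<close> by (subst sum.delta) auto
  finally show ?thesis by (simp add: M_def mprod_def twist_def)
qed

lemma opoly_T: "opoly N T (mat_tr K *\<^sub>c 1)"
proof -
  have "opoly N (\<lambda>z. \<Sum>i<3. M (z + 0) i i) (\<Sum>i<3. K $$ (i, i) *\<^sub>c 1)"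
    by (intro opoly_sum opoly_M) auto
  then show ?thesis
    using K by (simp add: T_def[abs_def] mat_tr_def endo.scale_sum_left)
qed

text \<open>In top degree the shift by \<eta> disappears and quantum minors become ordinary minors
  of \<open>K\<close>. Their trace gives the second elementary symmetric function of its
  eigenvalues.\<close>

lemma opoly_T2: "opoly (2 * N) T2 ((((mat_tr K)\<^sup>2 - mat_tr (K * K)) / 2) *\<^sub>c 1)"
proof -
  have "opoly (N + N) (\<lambda>z. \<Sum>i<3. \<Sum>k<3. M (z + 0) i i * M (z + \<eta>) k k - M (z + 0) k i * M (z + \<eta>) i k)
     (\<Sum>i<3. \<Sum>k<3. (K $$ (i, i) *\<^sub>c 1) * (K $$ (k, k) *\<^sub>c 1) - (K $$ (k, i) *\<^sub>c 1) * (K $$ (i, k) *\<^sub>c 1))"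
    by (intro opoly_sum opoly_diff opoly_mult opoly_M) auto
  also have "(\<Sum>i<3. \<Sum>k<3. (K $$ (i, i) *\<^sub>c 1) * (K $$ (k, k) *\<^sub>c 1) - (K $$ (k, i) *\<^sub>c 1) * (K $$ (i, k) *\<^sub>c 1))
      = ((mat_tr K)\<^sup>2 - mat_tr (K * K)) *\<^sub>c (1 :: 'i endo)"
  proof -
    have "(mat_tr K)\<^sup>2 = (\<Sum>i<3. \<Sum>k<3. K $$ (i, i) * K $$ (k, k))"
      using K by (simp add: mat_tr_def power2_eq_square sum_product)
    moreover have "mat_tr (K * K) = (\<Sum>i<3. \<Sum>k<3. K $$ (k, i) * K $$ (i, k))"
      using K by (simp add: mat_tr_def scalar_prod_def lessThan_atLeast0 mult.commute)
    ultimately show ?thesis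
      by (intro endo_eqI) (simp add: sum_distrib_left right_diff_distrib sum_subtractf mult_ac)
  qed
  finally have "opoly (N + N) (trace_minors \<eta> M) (((mat_tr K)\<^sup>2 - mat_tr (K * K)) *\<^sub>c 1)"
    by (simp add: trace_minors_def[abs_def] minor_def)
  from opoly_scale[OF this, of "1 / 2"] show ?thesis
    by (simp add: T2_def[abs_def] mult_2)
qed

end

section \<open>Fusion relations and matrix elements at generic inhomogeneities\<close>

text \<open>The nodes \<open>Z\<close> are arbitrary: a combination of the \<open>g_fun\<close> has
  degree below \<open>N\<close>. This freedom is what allows nodes adapted to \<open>h\<close> in
  \<open>matrix_element_T\<close>.\<close>

lemma g_interpolation_zero:
  assumes "finite Z" "card Z = N" "\<And>z. z \<in> Z \<Longrightarrow> (\<Sum>a\<in>{1..N}. g_fun N \<xi> a z * y a) = 0"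
  shows "(\<Sum>a\<in>{1..N}. g_fun N \<xi> a z * y a) = 0"
proof -
  define q where "q = (\<Sum>a\<in>{1..N}. Polynomial.smult (y a) (g_poly N \<xi> a))"
  have q: "poly q z = (\<Sum>a\<in>{1..N}. g_fun N \<xi> a z * y a)" for z
    by (simp add: q_def poly_sum poly_g_poly mult.commute)
  have "degree q \<le> N"
    unfolding q_def using degree_g_poly[of _ N \<xi>]
    by (intro degree_sum_le) (auto intro: order_trans[OF degree_smult_le] less_imp_le)
  moreover have "coeff q N = 0"
    unfolding q_def using degree_g_poly[of _ N \<xi>] by (auto simp: coeff_sum coeff_eq_0)
  ultimately have "q = 0"
    using assms q by (intro poly_eq_0_if_many_roots[of q N Z]) auto
  with q[of z] show ?thesis by simp
qed

lemma f_interpolation_zero: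
  assumes "finite Z" "card Z = 2 * N" "\<And>z. z \<in> Z \<Longrightarrow> (\<Sum>a\<in>{1..N}. f_fun N \<eta> \<xi> a z * y a) = 0"
  shows "(\<Sum>a\<in>{1..N}. f_fun N \<eta> \<xi> a z * y a) = 0"
proof -
  define q where "q = (\<Sum>a\<in>{1..N}. Polynomial.smult (y a) (f_poly N \<eta> \<xi> a))"
  have q: "poly q z = (\<Sum>a\<in>{1..N}. f_fun N \<eta> \<xi> a z * y a)" for z
    by (simp add: q_def poly_sum poly_f_poly mult.commute)
  have "degree q \<le> 2 * N"
    unfolding q_def using degree_f_poly[of _ N \<eta> \<xi>]
    by (intro degree_sum_le) (auto intro: order_trans[OF degree_smult_le] less_imp_le)
  moreover have "coeff q (2 * N) = 0"
    unfolding q_def using degree_f_poly[of _ N \<eta> \<xi>] by (auto simp: coeff_sum coeff_eq_0)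
  ultimately have "q = 0"
    using assms q by (intro poly_eq_0_if_many_roots[of q "2 * N" Z]) auto
  with q[of z] show ?thesis by simp
qed

locale generic_spin_chain = spin_chain +
  assumes eta: "\<eta> \<noteq> 0"
    and generic: "\<lbrakk>a \<in> {1..N}; b \<in> {1..N}; a \<noteq> b; r \<in> {-2..2::int}\<rbrakk> \<Longrightarrow> \<xi> a \<noteq> \<xi> b + of_int r * \<eta>"
begin

lemma inj_xi: "inj_on \<xi> {1..N}"
  by (rule inj_onI, rule ccontr) (use generic[where r = 0] in auto)

text \<open>The case \<open>a = b\<close> is included and rests on
  \<open>\<eta> \<noteq> 0\<close>.\<close>

lemma xi_shift:
  assumes "a \<in> {1..N}" "b \<in> {1..N}"
  shows "\<xi> a - \<eta> \<noteq> \<xi> b" "\<xi> a - 2 * \<eta> \<noteq> \<xi> b" "\<xi> a - 2 * \<eta> \<noteq> \<xi> b - \<eta>"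
  using eta generic[OF assms, of 1] generic[OF assms, of 2] by (cases "a = b"; auto simp: algebra_simps)+

lemma f_node:
  assumes "a \<in> {1..N}" "b \<in> {1..N}"
  shows "f_fun N \<eta> \<xi> a (\<xi> b - \<eta>) = (if a = b then 1 else 0)" "f_fun N \<eta> \<xi> a (\<xi> b) = 0"
  using f_fun_node[OF inj_xi assms] xi_shift(1)[OF assms(1)] by blast+

lemma T_interpolation:
  "T z = (mat_tr K * (\<Prod>a\<in>{1..N}. z - \<xi> a)) *\<^sub>c 1 + (\<Sum>a\<in>{1..N}. g_fun N \<xi> a z *\<^sub>c T (\<xi> a))"
proof (rule opoly_eqI[where F = T and Z = "\<xi> ` {1..N}" and d = N and z = z, OF opoly_T])
  let ?P = "\<Prod>a\<in>{1..N}. [:- \<xi> a, 1:]"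
  have "opoly N (\<lambda>z. poly (Polynomial.smult (mat_tr K) ?P) z *\<^sub>c 1 + (\<Sum>a\<in>{1..N}. poly (g_poly N \<xi> a) z *\<^sub>c T (\<xi> a)))
      (coeff (Polynomial.smult (mat_tr K) ?P) N *\<^sub>c 1 + (\<Sum>a\<in>{1..N}. 0))"
    using degree_prod_monic_linear(1)[of "{1..N}" "\<lambda>a. - \<xi> a"]
    by (intro opoly_add opoly_sum opoly_scalar opoly_less[OF opoly_scalar[OF order.refl]] degree_g_poly)
       (auto intro: order_trans[OF degree_smult_le])
  then show "opoly N (\<lambda>z. (mat_tr K * (\<Prod>a\<in>{1..N}. z - \<xi> a)) *\<^sub>c 1 + (\<Sum>a\<in>{1..N}. g_fun N \<xi> a z *\<^sub>c T (\<xi> a))) (mat_tr K *\<^sub>c 1)"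
    using degree_prod_monic_linear(2)[of "{1..N}" "\<lambda>a. - \<xi> a"]
    by (simp add: poly_g_poly poly_prod)
next
  show "card (\<xi> ` {1..N}) = N" using inj_xi by (simp add: card_image)
next
  fix y assume "y \<in> \<xi> ` {1..N}"
  then obtain b where b: "b \<in> {1..N}" "y = \<xi> b" by auto
  then have "(\<Prod>a\<in>{1..N}. y - \<xi> a) = 0" by auto
  moreover have "(\<Sum>a\<in>{1..N}. g_fun N \<xi> a y *\<^sub>c T (\<xi> a)) = (\<Sum>a\<in>{1..N}. if a = b then T (\<xi> b) else 0)"
    using b by (intro sum.cong refl) (auto simp: g_fun_node[OF inj_xi])
  ultimately show "T y = (mat_tr K * (\<Prod>a\<in>{1..N}. y - \<xi> a)) *\<^sub>c 1 + (\<Sum>a\<in>{1..N}. g_fun N \<xi> a y *\<^sub>c T (\<xi> a))"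
    using b by (simp add: sum.delta)
qed simp

text \<open>The \<open>2 * N\<close> nodes are the \<xi> n, where \<open>T2\<close> vanishes, and
  the \<xi> n - \<eta>, where fusion gives its value.\<close>

lemma T2_interpolation:
  "T2 z = T2_inf N \<eta> \<xi> K z *\<^sub>c 1 + (\<Sum>n\<in>{1..N}. f_fun N \<eta> \<xi> n z *\<^sub>c (T (\<xi> n - \<eta>) * T (\<xi> n)))"
proof (rule opoly_eqI[where F = T2 and Z = "\<xi> ` {1..N} \<union> (\<lambda>n. \<xi> n - \<eta>) ` {1..N}" and d = "2 * N" and z = z, OF opoly_T2])
  let ?c = "((mat_tr K)\<^sup>2 - mat_tr (K * K)) / 2"
  let ?P = "\<Prod>a\<in>{1..N}. [:- \<xi> a, 1:]" and ?Q = "\<Prod>a\<in>{1..N}. [:\<eta> - \<xi> a, 1:]"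
  have deg: "degree ?P = N" "degree ?Q = N" and lc: "lead_coeff ?P = 1" "lead_coeff ?Q = 1"
    using degree_prod_monic_linear[of "{1..N}" "\<lambda>a. - \<xi> a"] degree_prod_monic_linear[of "{1..N}" "\<lambda>a. \<eta> - \<xi> a"]
    by simp_all
  have "degree (?P * ?Q) = 2 * N" "coeff (?P * ?Q) (2 * N) = 1"
    using deg lc lead_coeff_mult[of ?P ?Q] by (auto simp: degree_mult_eq prod_zero_iff mult_2)
  moreover have "opoly (2 * N) (\<lambda>z. poly (Polynomial.smult ?c (?P * ?Q)) z *\<^sub>c 1 +
        (\<Sum>n\<in>{1..N}. poly (f_poly N \<eta> \<xi> n) z *\<^sub>c (T (\<xi> n - \<eta>) * T (\<xi> n))))
      (coeff (Polynomial.smult ?c (?P * ?Q)) (2 * N) *\<^sub>c 1 + (\<Sum>n\<in>{1..N}. 0))"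
    using calculation
    by (intro opoly_add opoly_sum opoly_scalar opoly_less[OF opoly_scalar[OF order.refl]] degree_f_poly)
       (auto intro: order_trans[OF degree_smult_le])
  ultimately show "opoly (2 * N) (\<lambda>z. T2_inf N \<eta> \<xi> K z *\<^sub>c 1 +
        (\<Sum>n\<in>{1..N}. f_fun N \<eta> \<xi> n z *\<^sub>c (T (\<xi> n - \<eta>) * T (\<xi> n)))) (?c *\<^sub>c 1)"
    unfolding T2_inf_def prod.distrib
    by (simp add: poly_f_poly poly_prod algebra_simps)
next
  have "\<xi> ` {1..N} \<inter> (\<lambda>n. \<xi> n - \<eta>) ` {1..N} = {}" using xi_shift(1) by fastforce
  moreover have "inj_on (\<lambda>n. \<xi> n - \<eta>) {1..N}"
    by (rule inj_onI) (rule inj_onD[OF inj_xi], simp_all)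
  ultimately show "card (\<xi> ` {1..N} \<union> (\<lambda>n. \<xi> n - \<eta>) ` {1..N}) = 2 * N"
    using inj_xi by (simp add: card_Un_disjoint card_image)
next
  fix y assume "y \<in> \<xi> ` {1..N} \<union> (\<lambda>n. \<xi> n - \<eta>) ` {1..N}"
  then consider b where "b \<in> {1..N}" "y = \<xi> b" | b where "b \<in> {1..N}" "y = \<xi> b - \<eta>" by auto
  then show "T2 y = T2_inf N \<eta> \<xi> K y *\<^sub>c 1 + (\<Sum>n\<in>{1..N}. f_fun N \<eta> \<xi> n y *\<^sub>c (T (\<xi> n - \<eta>) * T (\<xi> n)))"
  proof cases
    case 1
    then have "T2_inf N \<eta> \<xi> K y = 0" by (auto simp: T2_inf_def)
    with 1 show ?thesis
      using T2_zero[OF eta] by (simp add: f_node)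
  next
    case 2
    then have "T2_inf N \<eta> \<xi> K y = 0" by (auto simp: T2_inf_def)
    moreover have "(\<Sum>n\<in>{1..N}. f_fun N \<eta> \<xi> n y *\<^sub>c (T (\<xi> n - \<eta>) * T (\<xi> n))) =
        (\<Sum>n\<in>{1..N}. if n = b then T (\<xi> b - \<eta>) * T (\<xi> b) else 0)"
      using 2 by (intro sum.cong refl) (auto simp: f_node)
    ultimately show ?thesis
      using 2 T2_fusion[OF eta] by (simp add: sum.delta)
  qed
qed simp

lemma T_xi_commute:
  assumes "a \<in> {1..N}" "b \<in> {1..N}"
  shows "T (\<xi> a) * T (\<xi> b) = T (\<xi> b) * T (\<xi> a)"
proof (cases "a = b")
  case False
  have "(\<xi> a - \<xi> b)\<^sup>2 \<noteq> \<eta>\<^sup>2"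
    using generic[OF assms False, of 1] generic[OF assms False, of "-1"]
    by (auto simp: power2_eq_iff algebra_simps)
  then show ?thesis by (rule T_commute)
qed simp

text \<open>The RTT argument leaves exceptional pairs of points. Interpolation expresses
  \<open>T z\<close> through the nodes, so commutation there extends to every
  \<open>z\<close>.\<close>

lemma T_commute_xi: "a \<in> {1..N} \<Longrightarrow> T (\<xi> a) * T z = T z * T (\<xi> a)"
  unfolding T_interpolation[of z]
  by (simp add: distrib_left distrib_right sum_distrib_left sum_distrib_right T_xi_commute)

lemma T2_commute_xi: "a \<in> {1..N} \<Longrightarrow> T (\<xi> a) * T2 z = T2 z * T (\<xi> a)"
proof -
  assume a: "a \<in> {1..N}"
  have "T (\<xi> a) * (T (\<xi> n - \<eta>) * T (\<xi> n)) = T (\<xi> n - \<eta>) * T (\<xi> n) * T (\<xi> a)" if "n \<in> {1..N}" for n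
    using T_commute_xi[OF a] T_xi_commute[OF a that] by (metis mult.assoc)
  then show ?thesis
    unfolding T2_interpolation[of z]
    by (simp add: distrib_left distrib_right sum_distrib_left sum_distrib_right)
qed

text \<open>The scalar counterpart of \<open>T2_interpolation\<close>, equal at \<xi> a - 2\<eta> to
  the bracket in the cubic equations.\<close>

definition t2_of :: "(nat \<Rightarrow> complex) \<Rightarrow> complex \<Rightarrow> complex" where
  "t2_of x z = T2_inf N \<eta> \<xi> K z + (\<Sum>n\<in>{1..N}. f_fun N \<eta> \<xi> n z * t1_of N \<xi> K x (\<xi> n - \<eta>) * x n)"

lemma t1_of_xi: "b \<in> {1..N} \<Longrightarrow> t1_of N \<xi> K x (\<xi> b) = x b"
proof -
  assume b: "b \<in> {1..N}"
  have "(\<Sum>a\<in>{1..N}. g_fun N \<xi> a (\<xi> b) * x a) = (\<Sum>a\<in>{1..N}. if a = b then x b else 0)"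
    using b by (intro sum.cong refl) (auto simp: g_fun_node[OF inj_xi])
  moreover have "(\<Prod>a\<in>{1..N}. \<xi> b - \<xi> a) = 0" using b by auto
  ultimately show ?thesis using b by (simp add: t1_of_def sum.delta)
qed

lemma t2_of_xi: "b \<in> {1..N} \<Longrightarrow> t2_of x (\<xi> b - \<eta>) = t1_of N \<xi> K x (\<xi> b - \<eta>) * x b"
proof -
  assume b: "b \<in> {1..N}"
  have "(\<Sum>n\<in>{1..N}. f_fun N \<eta> \<xi> n (\<xi> b - \<eta>) * t1_of N \<xi> K x (\<xi> n - \<eta>) * x n) =
      (\<Sum>n\<in>{1..N}. if n = b then t1_of N \<xi> K x (\<xi> b - \<eta>) * x b else 0)"
    using b by (intro sum.cong refl) (auto simp: f_node)
  moreover have "T2_inf N \<eta> \<xi> K (\<xi> b - \<eta>) = 0" using b by (auto simp: T2_inf_def)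
  ultimately show ?thesis using b by (simp add: t2_of_def sum.delta)
qed

lemma Sigma_T_iff:
  "x \<in> Sigma_T N \<eta> \<xi> K \<longleftrightarrow> (\<forall>n. n \<notin> {1..N} \<longrightarrow> x n = 0) \<and>
     (\<forall>a\<in>{1..N}. x a * t2_of x (\<xi> a - 2 * \<eta>) = q_det N \<eta> \<xi> K (\<xi> a - 2 * \<eta>))"
  by (simp add: Sigma_T_def t2_of_def)

text \<open>Applied to \<open>v\<close>, the interpolation formulas give the eigenvalues of
  \<open>T\<close> and \<open>T2\<close>, and \<open>T2_mult_T\<close> becomes the cubic equation.
  The value 0 outside \<open>{1..N}\<close> is the normalisation required by
  \<open>Sigma_T\<close>.\<close>

lemma eigenvalue_in_Sigma_T:
  assumes eig: "\<And>z. app (T z) v = (\<lambda>p. t z * v p)" and "v p0 \<noteq> 0"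
  defines "x \<equiv> \<lambda>a. if a \<in> {1..N} then t (\<xi> a) else 0"
  shows "t = t1_of N \<xi> K x" "x \<in> Sigma_T N \<eta> \<xi> K"
proof -
  have xa: "x a = t (\<xi> a)" if "a \<in> {1..N}" for a using that by (simp add: x_def)
  show t: "t = t1_of N \<xi> K x"
  proof
    fix z
    have "t z * v p0 = app (T z) v p0" by (simp add: eig)
    also have "\<dots> = t1_of N \<xi> K x z * v p0"
      by (subst T_interpolation)
         (simp add: eig t1_of_def xa distrib_right sum_distrib_right mult.assoc)
    finally show "t z = t1_of N \<xi> K x z" using assms(2) by simp
  qed
  have T2: "app (T2 z) v p = t2_of x z * v p" for z p
    by (subst T2_interpolation)
       (simp add: eig app_cmult t2_of_def xa distrib_right sum_distrib_right t[symmetric], simp add: mult_ac)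
  have "x a * t2_of x (\<xi> a - 2 * \<eta>) = q_det N \<eta> \<xi> K (\<xi> a - 2 * \<eta>)" if a: "a \<in> {1..N}" for a
  proof -
    have "q_det N \<eta> \<xi> K (\<xi> a - 2 * \<eta>) * v p0 = app (T2 (\<xi> a - 2 * \<eta>) * T (\<xi> a)) v p0"
      by (simp only: T2_mult_T[OF eta a]) simp
    also have "\<dots> = x a * t2_of x (\<xi> a - 2 * \<eta>) * v p0"
      by (simp add: eig app_cmult T2 xa[OF a])
    finally show ?thesis using assms(2) by simp
  qed
  then show "x \<in> Sigma_T N \<eta> \<xi> K"
    by (auto simp: Sigma_T_iff x_def)
qed

text \<open>\<open>m h A\<close> stands for the matrix element \<open>\<langle>h|A|t\<rangle>\<close>.  Raising \<open>h a\<close> beyond 2 is avoided by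
evaluating \<open>T\<close> at \<open>\<xi> a - \<eta>\<close> instead of \<open>\<xi> a\<close> whenever \<open>h a = 2\<close>: fusion then turns
\<open>\<langle>h|T(\<xi> a - \<eta>)\<close> into \<open>\<langle>h'|T2(\<xi> a - \<eta>)\<close> with \<open>h' = h(a := 1)\<close>, and \<open>T2\<close> is known on \<open>\<langle>h'|\<close> at
\<open>\<xi> b - 2\<eta>\<close> (by the quantum determinant, if \<open>h' b > 0\<close>) and at \<open>\<xi> b - \<eta>\<close> (by fusion and induction
on the number of twos, if \<open>h' b = 0\<close>).\<close>

lemma matrix_element_T:
  fixes m :: "(nat \<Rightarrow> nat) \<Rightarrow> 'a endo \<Rightarrow> complex"
  assumes add: "\<And>h A B. m h (A + B) = m h A + m h B"
    and scale: "\<And>h c A. m h (c *\<^sub>c A) = c * m h A"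
    and shift: "\<And>h a A. a \<in> {1..N} \<Longrightarrow> m h (T (\<xi> a) * A) = m (h(a := Suc (h a))) A"
    and one: "\<And>h. h \<in> tuples012 N \<Longrightarrow> m h 1 = (\<Prod>n\<in>{1..N}. x n ^ h n)"
    and x: "x \<in> Sigma_T N \<eta> \<xi> K"
    and "h \<in> tuples012 N"
  shows "m h (T z) = t1_of N \<xi> K x z * (\<Prod>n\<in>{1..N}. x n ^ h n)"
  using assms(6)
proof (induction "card {n \<in> {1..N}. h n = 2}" arbitrary: h z rule: less_induct)
  case less
  define mon where "mon h = (\<Prod>n\<in>{1..N}. x n ^ h n)" for h :: "nat \<Rightarrow> nat"
  have zero: "m h 0 = 0" for h using scale[of h 0 0] by simp
  have sum: "m h (\<Sum>i\<in>I. A i) = (\<Sum>i\<in>I. m h (A i))" for h A and I :: "nat set"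
    by (induction I rule: infinite_finite_induct) (auto simp: zero add)
  have mon_Suc: "mon (h(a := Suc (h a))) = x a * mon h" if "a \<in> {1..N}" for a h
    using that by (simp add: mon_def prod.remove[of _ a])
  have m_xi: "m h (T (\<xi> b)) = x b * mon h" if "h \<in> tuples012 N" "b \<in> {1..N}" "h b < 2" for h b
  proof -
    have "m h (T (\<xi> b) * 1) = m (h(b := Suc (h b))) 1" by (rule shift[OF that(2)])
    also have "\<dots> = mon (h(b := Suc (h b)))"
      unfolding mon_def using that by (intro one) (auto simp: tuples012_def)
    finally show ?thesis by (simp add: mon_Suc[OF that(2)])
  qed
  \<comment> \<open>The terms of top degree cancel, so the deviation from the expected value is a
    combination of the \<open>g_fun\<close> and dies once it vanishes at \<open>N\<close> nodes.
    \<open>diff_T2\<close> is the analogue with \<open>f_fun\<close> and \<open>2 * N\<close>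
    nodes.\<close>
  have diff_T: "m h (T z) - t1_of N \<xi> K x z * mon h =
      (\<Sum>a\<in>{1..N}. g_fun N \<xi> a z * (m h (T (\<xi> a)) - x a * mon h))" if "h \<in> tuples012 N" for h z
    using one[OF that] unfolding T_interpolation[of z] t1_of_def add scale sum mon_def[symmetric]
    by (simp add: algebra_simps sum_subtractf sum_distrib_left)
  have diff_T2: "m h (T2 z) - t2_of x z * mon h =
      (\<Sum>n\<in>{1..N}. f_fun N \<eta> \<xi> n z * (m h (T (\<xi> n - \<eta>) * T (\<xi> n)) - t1_of N \<xi> K x (\<xi> n - \<eta>) * x n * mon h))"
    if "h \<in> tuples012 N" for h z
    using one[OF that] unfolding T2_interpolation[of z] t2_of_def add scale sum mon_def[symmetric]
    by (simp add: algebra_simps sum_subtractf sum_distrib_left)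
  have T2_lower: "m (h(a := 1)) (T2 z) = t2_of x z * mon (h(a := 1))" if a: "a \<in> {1..N}" "h a = 2" for a z
  proof -
    define h' where "h' = h(a := 1)"
    have h': "h' \<in> tuples012 N" using less.prems a by (auto simp: h'_def tuples012_def)
    define \<zeta> where "\<zeta> b = (if h' b = 0 then \<xi> b - \<eta> else \<xi> b - 2 * \<eta>)" for b
    let ?Z = "\<xi> ` {1..N} \<union> \<zeta> ` {1..N}"
    have node: "m h' (T2 (\<zeta> b)) = t2_of x (\<zeta> b) * mon h'" if b: "b \<in> {1..N}" for b
    proof (cases "h' b = 0")
      case True
      then have "b \<noteq> a" by (auto simp: h'_def)
      let ?h = "h'(b := Suc (h' b))"
      \<comment> \<open>Component \<open>a\<close> has dropped from 2 to 1 and component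
        \<open>b\<close> rises only from 0 to 1, so the number of twos decreases.\<close>
      have "{n \<in> {1..N}. ?h n = 2} = {n \<in> {1..N}. h n = 2} - {a}"
        using True a by (auto simp: h'_def)
      then have "card {n \<in> {1..N}. ?h n = 2} < card {n \<in> {1..N}. h n = 2}"
        using a by (simp add: card_Diff1_less del: card_Diff_insert)
      moreover have "?h \<in> tuples012 N" using h' True b by (auto simp: tuples012_def)
      ultimately have IH: "m ?h (T (\<xi> b - \<eta>)) = t1_of N \<xi> K x (\<xi> b - \<eta>) * mon ?h"
        unfolding mon_def by (rule less.hyps)
      have "m h' (T2 (\<xi> b - \<eta>)) = m h' (T (\<xi> b) * T (\<xi> b - \<eta>))"
        using T2_fusion[OF eta b] T_commute_xi[OF b] by simp
      also have "\<dots> = t2_of x (\<xi> b - \<eta>) * mon h'"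
        unfolding shift[OF b] IH mon_Suc[OF b] t2_of_xi[OF b] by simp
      finally show ?thesis using True by (simp add: \<zeta>_def)
    next
      case False
      \<comment> \<open>One factor \<open>T (\<xi> b)\<close> is taken out of the covector and meets
        \<open>T2 (\<xi> b - 2 * \<eta>)\<close> in the quantum determinant. The subtraction does
        not truncate since \<open>h' b\<close> is positive.\<close>
      let ?h = "h'(b := h' b - 1)"
      have h'_eq: "h' = ?h(b := Suc (?h b))" using False by auto
      have "m h' (T2 (\<zeta> b)) = m ?h (T (\<xi> b) * T2 (\<xi> b - 2 * \<eta>))"
        unfolding shift[OF b] using h'_eq False by (simp add: \<zeta>_def)
      also have "\<dots> = q_det N \<eta> \<xi> K (\<xi> b - 2 * \<eta>) * m ?h 1"
        unfolding T2_commute_xi[OF b] T2_mult_T[OF eta b] scale ..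
      also have "m ?h 1 = mon ?h"
        unfolding mon_def using h' by (intro one) (force simp: tuples012_def)
      also have "q_det N \<eta> \<xi> K (\<xi> b - 2 * \<eta>) = x b * t2_of x (\<xi> b - 2 * \<eta>)"
        using x b by (simp add: Sigma_T_iff)
      also have "x b * t2_of x (\<xi> b - 2 * \<eta>) * mon ?h = t2_of x (\<xi> b - 2 * \<eta>) * mon (?h(b := Suc (?h b)))"
        unfolding mon_Suc[OF b] by simp
      finally show ?thesis unfolding h'_eq[symmetric] using False by (simp add: \<zeta>_def)
    qed
    have "inj_on \<zeta> {1..N}"
    proof (rule inj_onI, rule ccontr)
      fix b c assume "b \<in> {1..N}" "c \<in> {1..N}" "\<zeta> b = \<zeta> c" "b \<noteq> c"
      then show False
        using xi_shift(3)[of b c] xi_shift(3)[of c b] inj_onD[OF inj_xi, of b c]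
        by (auto simp: \<zeta>_def split: if_splits)
    qed
    moreover have "\<xi> ` {1..N} \<inter> \<zeta> ` {1..N} = {}"
    proof (intro equals0I, elim IntE imageE)
      fix y b c assume "y = \<xi> b" "b \<in> {1..N}" "y = \<zeta> c" "c \<in> {1..N}"
      then show False
        using xi_shift(1,2)[of c b] by (simp add: \<zeta>_def split: if_splits)
    qed
    ultimately have card_Z: "card ?Z = 2 * N"
      using inj_xi by (simp add: card_Un_disjoint card_image)
    have "m h' (T2 z) - t2_of x z * mon h' = 0"
      unfolding diff_T2[OF h']
    proof (rule f_interpolation_zero[OF _ card_Z])
      fix y assume "y \<in> ?Z"
      then consider b where "b \<in> {1..N}" "y = \<xi> b" | b where "b \<in> {1..N}" "y = \<zeta> b" by blast
      then show "(\<Sum>n\<in>{1..N}. f_fun N \<eta> \<xi> n y *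
          (m h' (T (\<xi> n - \<eta>) * T (\<xi> n)) - t1_of N \<xi> K x (\<xi> n - \<eta>) * x n * mon h')) = 0"
      proof cases
        \<comment> \<open>All \<open>f_fun\<close> vanish at \<xi> b, so these \<open>N\<close>
          nodes need no knowledge of \<open>m\<close>.\<close>
        case 1
        then show ?thesis by (simp add: f_node)
      next
        case 2
        then show ?thesis unfolding diff_T2[OF h', symmetric] using node by simp
      qed
    qed auto
    then show ?thesis by (simp add: h'_def)
  qed
  define \<zeta> where "\<zeta> a = (if h a = 2 then \<xi> a - \<eta> else \<xi> a)" for a
  have node: "m h (T (\<zeta> a)) = t1_of N \<xi> K x (\<zeta> a) * mon h" if a: "a \<in> {1..N}" for a
  proof (cases "h a = 2")
    case False
    with less.prems a have "h a < 2" by (force simp: tuples012_def)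
    with False show ?thesis
      using m_xi[OF less.prems a] t1_of_xi[OF a] by (simp add: \<zeta>_def)
  next
    case True
    let ?h = "h(a := 1)"
    have h_eq: "?h(a := Suc (?h a)) = h" using True by auto
    have "m h (T (\<xi> a - \<eta>)) = m ?h (T (\<xi> a) * T (\<xi> a - \<eta>))"
      unfolding shift[OF a] h_eq ..
    also have "\<dots> = m ?h (T2 (\<xi> a - \<eta>))"
      using T2_fusion[OF eta a] T_commute_xi[OF a] by simp
    also have "\<dots> = t1_of N \<xi> K x (\<xi> a - \<eta>) * mon (?h(a := Suc (?h a)))"
      unfolding T2_lower[OF a True] t2_of_xi[OF a] mon_Suc[OF a] by simp
    finally show ?thesis unfolding h_eq using True by (simp add: \<zeta>_def)
  qed
  have "inj_on \<zeta> {1..N}"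
  proof (rule inj_onI, rule ccontr)
    fix b c assume "b \<in> {1..N}" "c \<in> {1..N}" "\<zeta> b = \<zeta> c" "b \<noteq> c"
    then show False
      using xi_shift(1)[of b c] xi_shift(1)[of c b] inj_onD[OF inj_xi, of b c]
      by (auto simp: \<zeta>_def split: if_splits)
  qed
  then have card_Z: "card (\<zeta> ` {1..N}) = N" by (simp add: card_image)
  have "m h (T z) - t1_of N \<xi> K x z * mon h = 0"
    unfolding diff_T[OF less.prems]
  proof (rule g_interpolation_zero[OF _ card_Z])
    fix y assume "y \<in> \<zeta> ` {1..N}"
    then show "(\<Sum>a\<in>{1..N}. g_fun N \<xi> a y * (m h (T (\<xi> a)) - x a * mon h)) = 0"
      unfolding diff_T[OF less.prems, symmetric] using node by auto
  qed simp
  then show ?case by (simp add: mon_def)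
qed

end

section \<open>Bases of covectors\<close>

context vec_space
begin

text \<open>The pairing is bilinear without conjugation; orthogonality to \<open>B\<close> passes to
  its span, and the unit vectors there read off the coordinates of \<open>u\<close>.\<close>

lemma basis_separates:
  assumes B: "basis B" and u: "u \<in> carrier_vec n" and 0: "\<And>b. b \<in> B \<Longrightarrow> b \<bullet> u = 0"
  shows "u = 0\<^sub>v n"
proof -
  have B_carrier: "B \<subseteq> carrier_vec n" and span: "span B = carrier_vec n"
    using B by (auto simp: basis_def)
  have "u \<in> orthogonal_complement B"
    using u B_carrier 0 by (auto simp: orthogonal_complement_def comm_scalar_prod[of _ n])
  then have "u \<in> orthogonal_complement (carrier_vec n)"
    using in_orthogonal_complement_span[OF B_carrier] span by simp
  then have "u \<bullet> unit_vec n i = 0" if "i < n" for i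
    by (auto simp: orthogonal_complement_def)
  then show ?thesis
    using u by (intro eq_vecI) auto
qed

text \<open>The square matrix with the covectors of \<open>B\<close> as rows has trivial kernel by
  \<open>basis_separates\<close>, so the linear system for \<open>t\<close> is solvable.\<close>

lemma basis_dual:
  assumes B: "basis B"
  shows "\<exists>t\<in>carrier_vec n. \<forall>b\<in>B. b \<bullet> t = \<phi> b"
proof -
  have "finite B" using B fin_dim_li_fin[OF fin_dim] by (auto simp: basis_def)
  then have "card B = n" using dim_basis[OF _ B] dim_is_n by simp
  obtain bs where bs: "set bs = B" "distinct bs"
    using \<open>finite B\<close> finite_distinct_list by blast
  then have len: "length bs = n" using \<open>card B = n\<close> distinct_card by fastforce
  define A where "A = mat_of_rows n bs"
  have A: "A \<in> carrier_mat n n" using len by (auto simp: A_def)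
  have B_carrier: "B \<subseteq> carrier_vec n" using B by (auto simp: basis_def)
  have row: "row A i = bs ! i" if "i < n" for i
    using that len B_carrier bs(1) unfolding A_def by (intro mat_of_rows_row) auto
  have "u = 0\<^sub>v n" if u: "u \<in> carrier_vec n" "A *\<^sub>v u = 0\<^sub>v n" for u
  proof (rule basis_separates[OF B u(1)])
    fix b assume "b \<in> B"
    then obtain i where "i < n" "b = bs ! i" using bs(1) len by (metis in_set_conv_nth)
    then show "b \<bullet> u = 0" using arg_cong[OF u(2), of "\<lambda>v. v $ i"] A row by auto
  qed
  then have "det A \<noteq> 0" using det_0_iff_vec_prod_zero_field[OF A] by blast
  then obtain A' where A': "A' \<in> carrier_mat n n" "A * A' = 1\<^sub>m n"
    using det_non_zero_imp_unit[OF A, of "()"] by (auto simp: Units_def ring_mat_def)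
  define w where "w = vec n (\<lambda>i. \<phi> (bs ! i))"
  have "A *\<^sub>v (A' *\<^sub>v w) = w"
    using A A' by (simp add: assoc_mult_mat_vec[symmetric, of _ n n _ n] w_def)
  then have "row A i \<bullet> (A' *\<^sub>v w) = w $ i" if "i < n" for i
    using that A by (metis carrier_matD(1) index_mult_mat_vec)
  then have "bs ! i \<bullet> (A' *\<^sub>v w) = \<phi> (bs ! i)" if "i < n" for i
    using that by (simp add: row w_def)
  then have "\<forall>b\<in>B. b \<bullet> (A' *\<^sub>v w) = \<phi> b"
    using bs(1) len by (metis in_set_conv_nth)
  moreover have "A' *\<^sub>v w \<in> carrier_vec n"
    by (rule mult_mat_vec_carrier[OF A'(1)]) (simp add: w_def)
  ultimately show ?thesis by blast
qed

end

section \<open>Operators acting on ternary digits\<close>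

primrec setdigit :: "nat \<Rightarrow> nat \<Rightarrow> nat \<Rightarrow> nat" where
  "setdigit 0 j p = 3 * (p div 3) + j"
| "setdigit (Suc n) j p = 3 * setdigit n j (p div 3) + p mod 3"

lemma digit_0: "digit 0 p = p mod 3"
  by (simp add: digit_def)

lemma digit_Suc: "digit (Suc k) p = digit k (p div 3)"
  by (simp add: digit_def div_mult2_eq)

lemma digit_less [simp]: "digit k p < 3"
  by (simp add: digit_def)

text \<open>Lets the identities between \<open>setdigit\<close> operations be checked digit by
  digit.\<close>

lemma digit_eqI: "(\<And>k. digit k p = digit k q) \<Longrightarrow> p = q"
proof (induction "p + q" arbitrary: p q rule: less_induct)
  case less
  show ?case
  proof (cases "p + q = 0")
    case False
    then have "p div 3 + q div 3 < p + q" by linarith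
    moreover have "digit k (p div 3) = digit k (q div 3)" for k
      using less.prems[of "Suc k"] by (simp add: digit_Suc)
    ultimately have "p div 3 = q div 3" by (rule less.hyps)
    moreover have "p mod 3 = q mod 3" using less.prems[of 0] by (simp add: digit_0)
    ultimately show ?thesis by (metis mult_div_mod_eq)
  qed simp
qed

lemma digit_setdigit: "j < 3 \<Longrightarrow> digit k (setdigit n j p) = (if k = n then j else digit k p)"
proof (induction n arbitrary: k p)
  case 0
  then show ?case by (cases k) (auto simp: digit_0 digit_Suc)
next
  case (Suc n)
  then show ?case by (cases k) (auto simp: digit_0 digit_Suc)
qed

lemma digit_ge: "p < 3 ^ N \<Longrightarrow> N \<le> k \<Longrightarrow> digit k p = 0"
  using less_le_trans[of p "3 ^ N" "3 ^ k"] by (simp add: digit_def)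

lemma setdigit_less: "p < 3 ^ N \<Longrightarrow> n < N \<Longrightarrow> j < 3 \<Longrightarrow> setdigit n j p < 3 ^ N"
proof (induction n arbitrary: N p)
  case 0
  then obtain N' where "N = Suc N'" by (cases N) auto
  with 0 have "p div 3 < 3 ^ N'" by (auto simp: less_mult_imp_div_less mult.commute)
  with 0 \<open>N = Suc N'\<close> show ?case by auto
next
  case (Suc n)
  then obtain N' where N: "N = Suc N'" by (cases N) auto
  with Suc have "p div 3 < 3 ^ N'" by (auto simp: less_mult_imp_div_less mult.commute)
  with Suc N have "setdigit n j (p div 3) < 3 ^ N'" by auto
  with N show ?case by (auto intro: order.strict_trans2[of _ "3 * (setdigit n j (p div 3) + 1)"])
qed

lemma setdigit_setdigit: "j < 3 \<Longrightarrow> k < 3 \<Longrightarrow> setdigit n j (setdigit n k p) = setdigit n j p"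
  by (rule digit_eqI) (simp add: digit_setdigit)

lemma setdigit_digit: "setdigit n (digit n p) p = p"
  by (rule digit_eqI) (simp add: digit_setdigit)

lemma setdigit_commute:
  "m \<noteq> n \<Longrightarrow> j < 3 \<Longrightarrow> k < 3 \<Longrightarrow> setdigit m j (setdigit n k p) = setdigit n k (setdigit m j p)"
  by (rule digit_eqI) (simp add: digit_setdigit)

lemma setdigit_less_iff:
  assumes "n < N" "j < 3"
  shows "setdigit n j p < 3 ^ N \<longleftrightarrow> p < 3 ^ N"
  using setdigit_less[of p N n j] setdigit_less[of "setdigit n j p" N n "digit n p"] assms
  by (auto simp: setdigit_setdigit setdigit_digit)

text \<open>Vectors are functions of the basis index, so the digit is tested at the target and
  replaced at the source: the state with digit \<open>j\<close> goes to the one with digit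
  \<open>i\<close>.\<close>

lift_definition site_unit :: "nat \<Rightarrow> nat \<Rightarrow> nat \<Rightarrow> nat endo" is
  "\<lambda>n i j f p. if digit n p = i then f (setdigit n j p) else 0"
  by (auto simp: fun_eq_iff)

lemma app_site_unit: "app (site_unit n i j) f p = (if digit n p = i then f (setdigit n j p) else 0)"
  by (simp add: site_unit.rep_eq)

lemma matrix_units_site_unit: "matrix_units (site_unit n)"
  unfolding matrix_units_def
proof (intro conjI allI impI endo_eqI)
  fix i j k l f p assume "i < (3::nat)" "j < (3::nat)" "k < (3::nat)" "l < (3::nat)"
  then show "app (site_unit n i j * site_unit n k l) f p = app (if j = k then site_unit n i l else 0) f p"
    by (auto simp: app_site_unit digit_setdigit setdigit_setdigit)
next
  fix f p
  show "app (\<Sum>i<3. site_unit n i i) f p = app 1 f p"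
    by (simp add: app_site_unit setdigit_digit sum.delta' cong: if_cong)
qed

lemma site_unit_commute:
  assumes "m \<noteq> n" "i < 3" "j < 3" "k < 3" "l < 3"
  shows "site_unit m i j * site_unit n k l = site_unit n k l * site_unit m i j"
  using assms by (intro endo_eqI) (auto simp: app_site_unit digit_setdigit setdigit_commute[of m n])

text \<open>Operators act on functions on all of \<open>nat\<close>. Passing to \<open>D\<close> by
  \<open>D\<close> matrices respects products when the right factor keeps supports below
  \<open>D\<close>.\<close>

definition preserves :: "nat \<Rightarrow> nat endo \<Rightarrow> bool" where
  "preserves D A \<longleftrightarrow> (\<forall>f. (\<forall>p\<ge>D. f p = 0) \<longrightarrow> (\<forall>p\<ge>D. app A f p = 0))"

lemma preserves_simps:
  "preserves D 0" "preserves D 1" "preserves D A \<Longrightarrow> preserves D B \<Longrightarrow> preserves D (A + B)"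
  "preserves D A \<Longrightarrow> preserves D B \<Longrightarrow> preserves D (A * B)" "preserves D A \<Longrightarrow> preserves D (c *\<^sub>c A)"
  by (auto simp: preserves_def)

lemma preserves_sum: "(\<And>i. i \<in> I \<Longrightarrow> preserves D (A i)) \<Longrightarrow> preserves D (\<Sum>i\<in>I. A i)"
  by (induction I rule: infinite_finite_induct) (auto intro: preserves_simps)

lemma preserves_power: "preserves D A \<Longrightarrow> preserves D (A ^ k)"
  by (induction k) (auto intro: preserves_simps)

lemma preserves_site_unit: "n < N \<Longrightarrow> j < 3 \<Longrightarrow> preserves (3 ^ N) (site_unit n i j)"
  by (auto simp: preserves_def app_site_unit) (metis not_less setdigit_less_iff)

section \<open>Finite matrices of operators\<close>

definition ket :: "nat \<Rightarrow> nat \<Rightarrow> complex" where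
  "ket j = (\<lambda>p. if p = j then 1 else 0)"

definition opmat :: "nat \<Rightarrow> nat endo \<Rightarrow> complex mat" where
  "opmat D A = mat D D (\<lambda>(i, j). app A (ket j) i)"

lemma opmat_carrier [simp]: "opmat D A \<in> carrier_mat D D"
  by (simp add: opmat_def)

lemma app_expand:
  assumes "\<And>p. p \<ge> D \<Longrightarrow> f p = 0"
  shows "app A f i = (\<Sum>k<D. app A (ket k) i * f k)"
proof -
  have "f = (\<lambda>p. \<Sum>k<D. f k * ket k p)"
  proof
    fix p
    have "(\<Sum>k<D. f k * ket k p) = (\<Sum>k<D. if k = p then f p else 0)"
      by (intro sum.cong) (auto simp: ket_def)
    then show "f p = (\<Sum>k<D. f k * ket k p)"
      using assms[of p] by (simp add: not_less)
  qed
  then have "app A f i = app A (\<lambda>p. \<Sum>k<D. f k * ket k p) i" by simp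
  also have "\<dots> = (\<Sum>k<D. app A (ket k) i * f k)"
    by (simp add: app_sum app_cmult mult.commute)
  finally show ?thesis .
qed

lemma app_mult_ket:
  assumes "preserves D B" "j < D"
  shows "app (A * B) (ket j) i = (\<Sum>k<D. app A (ket k) i * app B (ket j) k)"
proof -
  have "app B (ket j) p = 0" if "p \<ge> D" for p
    using assms that by (auto simp: preserves_def ket_def)
  from app_expand[of D "app B (ket j)" A i, OF this] show ?thesis by simp
qed

lemma opmat_mult: "preserves D B \<Longrightarrow> opmat D (A * B) = opmat D A * opmat D B"
  by (rule eq_matI)
     (simp_all add: opmat_def app_mult_ket[simplified] scalar_prod_def lessThan_atLeast0)

lemma opmat_one: "opmat D 1 = 1\<^sub>m D"
  by (rule eq_matI) (auto simp: opmat_def ket_def)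

lemma opmat_power: "preserves D A \<Longrightarrow> opmat D (A ^ k) = opmat D A ^\<^sub>m k"
proof (induction k)
  case (Suc k)
  then show ?case by (simp add: opmat_mult power_Suc2 del: power_Suc)
qed (simp add: opmat_one, simp add: opmat_def)

definition vec_fun :: "complex vec \<Rightarrow> nat \<Rightarrow> complex" where
  "vec_fun v = (\<lambda>p. if p < dim_vec v then v $ p else 0)"

lemma opmat_mult_vec:
  assumes "v \<in> carrier_vec D"
  shows "opmat D A *\<^sub>v v = vec D (app A (vec_fun v))"
proof (rule eq_vecI)
  fix i assume "i < dim_vec (vec D (app A (vec_fun v)))"
  then have i: "i < D" by simp
  have "app A (vec_fun v) i = (\<Sum>k<D. app A (ket k) i * vec_fun v k)"
    using assms by (intro app_expand) (auto simp: vec_fun_def)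
  then show "(opmat D A *\<^sub>v v) $ i = vec D (app A (vec_fun v)) $ i"
    using i assms by (simp add: opmat_def scalar_prod_def lessThan_atLeast0 vec_fun_def)
qed (simp add: opmat_def)

lemma vec_fun_opmat:
  assumes "v \<in> carrier_vec D" "preserves D A"
  shows "vec_fun (opmat D A *\<^sub>v v) = app A (vec_fun v)"
proof
  fix p
  have "app A (vec_fun v) p = 0" if "p \<ge> D"
    using assms that by (auto simp: preserves_def vec_fun_def)
  then show "vec_fun (opmat D A *\<^sub>v v) p = app A (vec_fun v) p"
    by (auto simp: opmat_mult_vec[OF assms(1)] vec_fun_def)
qed

section \<open>Identification with the transfer matrix\<close>

text \<open>Separates the auxiliary digit \<open>e\<close> from the quantum index \<open>k\<close>
  when summing over the auxiliary space tensored with H.\<close>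

lemma sum_split3: "(\<Sum>k<3 * M. F k) = (\<Sum>e<3. \<Sum>k<M. F (e + 3 * k :: nat))"
proof -
  have "(\<Sum>e<3. \<Sum>k<M. F (e + 3 * k)) = (\<Sum>(e, k)\<in>{..<3} \<times> {..<M}. F (e + 3 * k))"
    by (rule sum.cartesian_product)
  also have "\<dots> = (\<Sum>k<3 * M. F k)"
    by (rule sum.reindex_bij_witness[of _ "\<lambda>x. (x mod 3, x div 3)" "\<lambda>(e, k). e + 3 * k"])
       (auto simp: less_mult_imp_div_less mult.commute)
  finally show ?thesis by simp
qed

context spin_chain
begin

primrec powprod :: "(nat \<Rightarrow> nat) \<Rightarrow> nat \<Rightarrow> 'i endo" where
  "powprod h 0 = 1"
| "powprod h (Suc m) = powprod h m * T (\<xi> (Suc m)) ^ h (Suc m)"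

lemma powprod_cong: "(\<And>n. n \<in> {1..m} \<Longrightarrow> h n = h' n) \<Longrightarrow> powprod h m = powprod h' m"
  by (induction m) auto

end

context generic_spin_chain
begin

text \<open>Commuting \<open>T (\<xi> a)\<close> to its own slot raises one exponent; this supplies
  the \<open>shift\<close> hypothesis of \<open>matrix_element_T\<close>.\<close>

lemma powprod_T:
  assumes "a \<in> {1..m}" "m \<le> N"
  shows "powprod h m * T (\<xi> a) = powprod (h(a := Suc (h a))) m"
  using assms
proof (induction m)
  case (Suc m)
  show ?case
  proof (cases "a = Suc m")
    case True
    have *: "powprod (h(a := Suc (h a))) m = powprod h m"
      using True by (intro powprod_cong) auto
    show ?thesis
      unfolding powprod.simps * using True by (simp add: mult.assoc power_commutes)
  next
    case False
    have "T (\<xi> (Suc m)) ^ k * T (\<xi> a) = T (\<xi> a) * T (\<xi> (Suc m)) ^ k" for k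
      using T_xi_commute[of "Suc m" a] Suc.prems by (intro power_commuting_commutes) auto
    then have "powprod h (Suc m) * T (\<xi> a) = powprod h m * T (\<xi> a) * T (\<xi> (Suc m)) ^ h (Suc m)"
      by (simp add: mult.assoc)
    with False Suc show ?thesis by simp
  qed
qed simp

end

locale digit_chain = spin_chain site_unit \<eta> \<xi> K N for \<eta> \<xi> K N
begin

lemma preserves_L: "n < N \<Longrightarrow> i < 3 \<Longrightarrow> preserves (3 ^ N) (L n z i j)"
  unfolding lax_def by (intro preserves_simps preserves_site_unit) (auto intro: preserves_simps)

lemma preserves_chain: "m \<le> N \<Longrightarrow> i < 3 \<Longrightarrow> preserves (3 ^ N) (chain m z i j)"
proof (induction m arbitrary: i)
  case 0
  then show ?case by (simp add: preserves_simps)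
next
  case (Suc m)
  then show ?case
    unfolding chain.simps mprod_def by (intro preserves_sum preserves_simps(4) preserves_L) auto
qed

lemma preserves_T: "preserves (3 ^ N) (T z)"
  unfolding T_def M_def mprod_def twist_def
  by (intro preserves_sum preserves_simps(4) preserves_chain) (auto intro: preserves_simps)

text \<open>Appending the auxiliary digit \<open>c\<close> as digit 0 moves digit \<open>n\<close>
  of \<open>i\<close> to position \<open>Suc n\<close> of \<open>c + 3 * i\<close>; the auxiliary
  blocks of \<open>R_an\<close> are then the entries of \<open>L n\<close>.\<close>

lemma R_an_entry:
  assumes "n < N" "c < 3" "e < 3" "i < 3 ^ N" "k < 3 ^ N"
  shows "R_an N \<eta> (Suc n) (z - \<xi> (Suc n)) $$ (c + 3 * i, e + 3 * k) = app (L n z c e) (ket k) i"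
proof -
  have bounds: "c + 3 * i < 3 ^ Suc N" "e + 3 * k < 3 ^ Suc N" using assms by auto
  have digits: "digit 0 (c + 3 * i) = c" "digit 0 (e + 3 * k) = e"
    "digit (Suc m) (c + 3 * i) = digit m i" "digit (Suc m) (e + 3 * k) = digit m k" for m
    using assms by (auto simp: digit_0 digit_Suc)
  have "setdigit n c i = k \<longleftrightarrow> digit n k = c \<and> (\<forall>m. m \<noteq> n \<longrightarrow> digit m i = digit m k)"
    using assms(2) by (metis digit_eqI digit_setdigit)
  \<comment> \<open>\<open>perm_an\<close> compares digits only up to \<open>N\<close>; the digits
    of \<open>i\<close> and \<open>k\<close> from position \<open>N\<close> on are 0, as both are
    below \<open>3 ^ N\<close>.\<close>
  also have "(\<forall>m. m \<noteq> n \<longrightarrow> digit m i = digit m k) \<longleftrightarrow>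
      (\<forall>m\<le>N. m \<noteq> 0 \<longrightarrow> m \<noteq> Suc n \<longrightarrow> digit m (c + 3 * i) = digit m (e + 3 * k))" (is "?l \<longleftrightarrow> ?r")
  proof
    assume ?l
    then show ?r by (auto simp: digits gr0_conv_Suc)
  next
    assume r: ?r
    show ?l
    proof (intro allI impI)
      fix m assume "m \<noteq> n"
      show "digit m i = digit m k"
      proof (cases "m < N")
        case True
        then show ?thesis using r[rule_format, of "Suc m"] \<open>m \<noteq> n\<close> by (simp add: digits)
      next
        case False
        then show ?thesis using digit_ge[OF assms(4)] digit_ge[OF assms(5)] by simp
      qed
    qed
  qed
  finally have set: "setdigit n c i = k \<longleftrightarrow> digit n k = c \<and>
      (\<forall>m\<le>N. m \<noteq> 0 \<longrightarrow> m \<noteq> Suc n \<longrightarrow> digit m (c + 3 * i) = digit m (e + 3 * k))" .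
  have eq: "c + 3 * i = e + 3 * k \<longleftrightarrow> c = e \<and> i = k"
    using digits(1,2) by (metis add_left_cancel mult_cancel1 zero_neq_numeral)
  have "perm_an N (Suc n) $$ (c + 3 * i, e + 3 * k) = app (site_unit n e c) (ket k) i"
    using bounds digits(1,2) unfolding app_site_unit ket_def set perm_an_def
    by (auto simp: digits(3,4)[of n])
  then show ?thesis
    using bounds by (auto simp: R_an_def lax_def eq ket_def perm_an_def)
qed

lemma R_an_carrier [simp]: "R_an N \<eta> n z \<in> carrier_mat (3 ^ Suc N) (3 ^ Suc N)"
  by (simp add: R_an_def perm_an_def)

lemma R_prod_carrier [simp]: "R_prod N \<eta> \<xi> z m \<in> carrier_mat (3 ^ Suc N) (3 ^ Suc N)"
proof (induction m)
  case (Suc m)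
  show ?case unfolding R_prod.simps by (rule mult_carrier_mat[OF R_an_carrier Suc.IH])
qed simp

text \<open>Block multiplication: the auxiliary digits index the blocks, and each block is the
  matrix of an operator on H.\<close>

lemma aux_mult_entry:
  assumes "A \<in> carrier_mat (3 ^ Suc N) (3 ^ Suc N)" "B \<in> carrier_mat (3 ^ Suc N) (3 ^ Suc N)"
    and "c < 3" "d < 3" "i < 3 ^ N" "j < 3 ^ N"
    and A: "\<And>e k. e < 3 \<Longrightarrow> k < 3 ^ N \<Longrightarrow> A $$ (c + 3 * i, e + 3 * k) = app (F z c e) (ket k) i"
    and B: "\<And>e k. e < 3 \<Longrightarrow> k < 3 ^ N \<Longrightarrow> B $$ (e + 3 * k, d + 3 * j) = app (G z e d) (ket j) k"
    and G: "\<And>e. e < 3 \<Longrightarrow> preserves (3 ^ N) (G z e d)"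
  shows "(A * B) $$ (c + 3 * i, d + 3 * j) = app (mprod F G z c d) (ket j) i"
proof -
  have "c + 3 * i < 3 ^ Suc N" "d + 3 * j < 3 ^ Suc N" using assms(3-6) by auto
  then have "(A * B) $$ (c + 3 * i, d + 3 * j) =
      (\<Sum>k<3 * 3 ^ N. A $$ (c + 3 * i, k) * B $$ (k, d + 3 * j))"
    using assms(1,2) by (simp add: scalar_prod_def lessThan_atLeast0)
  also have "\<dots> = (\<Sum>e<3. \<Sum>k<3 ^ N. app (F z c e) (ket k) i * app (G z e d) (ket j) k)"
    unfolding sum_split3 using A B by (intro sum.cong refl) auto
  also have "\<dots> = (\<Sum>e<3. app (F z c e * G z e d) (ket j) i)"
    using G assms(6) by (intro sum.cong refl app_mult_ket[symmetric]) auto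
  finally show ?thesis by (simp add: mprod_def)
qed

lemma R_prod_entry:
  assumes "m \<le> N" "c < 3" "d < 3" "i < 3 ^ N" "j < 3 ^ N"
  shows "R_prod N \<eta> \<xi> z m $$ (c + 3 * i, d + 3 * j) = app (chain m z c d) (ket j) i"
  using assms
proof (induction m arbitrary: c i)
  case 0
  then have "c + 3 * i < 3 ^ Suc N" "d + 3 * j < 3 ^ Suc N" by auto
  moreover have "c + 3 * i = d + 3 * j \<longleftrightarrow> c = d \<and> i = j"
    using 0 by (metis add_left_cancel digit_0 mod_less mod_mult_self2 mult_cancel1 zero_neq_numeral)
  ultimately show ?case by (auto simp: ket_def)
next
  case (Suc m)
  show ?case
    unfolding R_prod.simps chain.simps
    by (rule aux_mult_entry[OF R_an_carrier R_prod_carrier])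
       (use Suc in \<open>auto intro: R_an_entry preserves_chain\<close>)
qed

lemma monodromy_entry:
  assumes "c < 3" "d < 3" "i < 3 ^ N" "j < 3 ^ N"
  shows "monodromy N \<eta> \<xi> K z $$ (c + 3 * i, d + 3 * j) = app (M z c d) (ket j) i"
  unfolding monodromy_def M_def
proof (rule aux_mult_entry[OF _ R_prod_carrier])
  show "K_a N K \<in> carrier_mat (3 ^ Suc N) (3 ^ Suc N)" by (simp add: K_a_def)
  fix e k :: nat assume *: "e < 3" "k < 3 ^ N"
  then have "c + 3 * i < 3 ^ Suc N" "e + 3 * k < 3 ^ Suc N" using assms by auto
  then show "K_a N K $$ (c + 3 * i, e + 3 * k) = app (twist z c e) (ket k) i"
    using * assms by (auto simp: K_a_def twist_def ket_def digit_0)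
qed (use assms in \<open>auto intro: R_prod_entry preserves_chain\<close>)

lemma T1K_eq_opmat: "T1K N \<eta> \<xi> K z = opmat (3 ^ N) (T z)"
  by (rule eq_matI) (auto simp: T1K_def ptrace_a_def opmat_def T_def monodromy_entry)

lemma T_power_prod_eq_opmat: "T_power_prod N \<eta> \<xi> K h m = opmat (3 ^ N) (powprod h m)"
  by (induction m)
     (simp_all add: opmat_one T1K_eq_opmat opmat_power[OF preserves_T, symmetric]
       opmat_mult[OF preserves_power[OF preserves_T]])

lemma SoV_covector_scalar_prod:
  assumes "S \<in> carrier_vec (3 ^ N)" "w \<in> carrier_vec (3 ^ N)"
  shows "SoV_covector N \<eta> \<xi> K S h \<bullet> w = (\<Sum>p<3 ^ N. S $ p * app (powprod h N) (vec_fun w) p)"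
proof -
  let ?A = "opmat (3 ^ N) (powprod h N)"
  have "SoV_covector N \<eta> \<xi> K S h = ?A\<^sup>T *\<^sub>v S"
    unfolding SoV_covector_def T_power_prod_eq_opmat covec_mult_def
    using assms(1) by (intro eq_vecI) (auto simp: opmat_def comm_scalar_prod[of S "3 ^ N"])
  then have "SoV_covector N \<eta> \<xi> K S h \<bullet> w = S \<bullet> (?A *\<^sub>v w)"
    using transpose_vec_mult_scalar[of ?A "3 ^ N" "3 ^ N" w S] assms by simp
  then show ?thesis
    by (simp add: opmat_mult_vec[OF assms(2)] scalar_prod_def lessThan_atLeast0)
qed

lemma eigenvector_iff:
  assumes "v \<in> carrier_vec (3 ^ N)"
  shows "T1K N \<eta> \<xi> K z *\<^sub>v v = c \<cdot>\<^sub>v v \<longleftrightarrow> app (T z) (vec_fun v) = (\<lambda>p. c * vec_fun v p)"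
proof
  assume *: "T1K N \<eta> \<xi> K z *\<^sub>v v = c \<cdot>\<^sub>v v"
  have "app (T z) (vec_fun v) = vec_fun (c \<cdot>\<^sub>v v)"
    unfolding *[symmetric] T1K_eq_opmat by (rule vec_fun_opmat[OF assms preserves_T, symmetric])
  then show "app (T z) (vec_fun v) = (\<lambda>p. c * vec_fun v p)"
    by (auto simp: vec_fun_def)
next
  assume "app (T z) (vec_fun v) = (\<lambda>p. c * vec_fun v p)"
  then show "T1K N \<eta> \<xi> K z *\<^sub>v v = c \<cdot>\<^sub>v v"
    unfolding T1K_eq_opmat opmat_mult_vec[OF assms]
    using assms by (intro eq_vecI) (auto simp: vec_fun_def)
qed

lemma powprod_eigenvector:
  assumes "\<And>z. app (T z) f = (\<lambda>p. t z * f p)"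
  shows "app (powprod h m) f = (\<lambda>p. (\<Prod>n\<in>{1..m}. t (\<xi> n) ^ h n) * f p)"
proof (induction m)
  case (Suc m)
  have "app (T z ^ k) f = (\<lambda>p. t z ^ k * f p)" for z k
    by (induction k) (auto simp: app_cmult assms)
  then show ?case by (simp add: app_cmult Suc.IH) (simp add: mult_ac)
qed simp

end

section \<open>The spectrum\<close>

context digit_chain
begin

lemma powprod_zero: "n \<in> {1..m} \<Longrightarrow> T (\<xi> n) = 0 \<Longrightarrow> 0 < h n \<Longrightarrow> powprod h m = 0"
proof (induction m)
  case (Suc m)
  then show ?case by (cases "n = Suc m") (auto simp: power_0_left)
qed simp

text \<open>All SoV coordinates of an eigenvector are fixed by its eigenvalue up to the single
  factor \<open>S \<bullet> v\<close>, the source of simplicity.\<close>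

lemma SoV_covector_eigenvector:
  assumes "S \<in> carrier_vec (3 ^ N)" "is_common_eigenvector (3 ^ N) (T1K N \<eta> \<xi> K) t v"
  shows "SoV_covector N \<eta> \<xi> K S h \<bullet> v = (\<Prod>n\<in>{1..N}. t (\<xi> n) ^ h n) * (S \<bullet> v)"
proof -
  have v: "v \<in> carrier_vec (3 ^ N)" and eig: "\<And>z. app (T z) (vec_fun v) = (\<lambda>p. t z * vec_fun v p)"
    using assms(2) eigenvector_iff by (auto simp: is_common_eigenvector_def)
  show ?thesis
    unfolding SoV_covector_scalar_prod[OF assms(1) v] powprod_eigenvector[OF eig]
    using v by (simp add: scalar_prod_def lessThan_atLeast0 vec_fun_def sum_distrib_left mult_ac)
qed

end

theorem theorem5p1:
  fixes \<eta> :: complex and N :: nat and \<xi> :: "nat \<Rightarrow> complex"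
    and K :: "complex mat" and S :: "complex vec"
  assumes N_pos: "N \<ge> 1"
    and K_wsimple: "w_simple_mat 3 K"
    and xi_generic: "\<forall>a \<in> {1..N}. \<forall>b \<in> {1..N}. a \<noteq> b \<longrightarrow>
                       (\<forall>r \<in> {-2..2::int}. \<xi> a \<noteq> \<xi> b + of_int r * \<eta>)"
    and S_basis: "is_SoV_basis N \<eta> \<xi> K S"
  shows "eigenvalues_family (3 ^ N) (T1K N \<eta> \<xi> K) = t1_of N \<xi> K ` Sigma_T N \<eta> \<xi> K
         \<and> w_simple_family (3 ^ N) (T1K N \<eta> \<xi> K)
         \<and> (\<forall>t \<in> eigenvalues_family (3 ^ N) (T1K N \<eta> \<xi> K).
               \<exists>v. is_common_eigenvector (3 ^ N) (T1K N \<eta> \<xi> K) t v \<and>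
                   (\<forall>h \<in> tuples012 N. SoV_covector N \<eta> \<xi> K S h \<bullet> v = (\<Prod>n \<in> {1..N}. t (\<xi> n) ^ h n)))"
proof -
  let ?D = "3 ^ N :: nat"
  let ?T = "T1K N \<eta> \<xi> K"
  let ?bra = "SoV_covector N \<eta> \<xi> K S"
  have K: "K \<in> carrier_mat 3 3" using K_wsimple by (simp add: w_simple_mat_def)
  interpret digit_chain \<eta> \<xi> K N
    using K by unfold_locales (auto simp: matrix_units_site_unit site_unit_commute)
  interpret V: vec_space "TYPE(complex)" ?D .
  have S: "S \<in> carrier_vec ?D" and inj: "inj_on ?bra (tuples012 N)" and basis: "V.basis (?bra ` tuples012 N)"
    using S_basis by (auto simp: is_SoV_basis_def)
  have separates: "u = 0\<^sub>v ?D" if "u \<in> carrier_vec ?D" "\<And>h. h \<in> tuples012 N \<Longrightarrow> ?bra h \<bullet> u = 0" for u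
    using V.basis_separates[OF basis] that by blast
  \<comment> \<open>\<open>basis_dual\<close> prescribes values on a set of covectors; injectivity
    lets them be prescribed by the label \<open>h\<close>.\<close>
  have dual: "\<exists>t\<in>carrier_vec ?D. \<forall>h\<in>tuples012 N. ?bra h \<bullet> t = \<phi> h" for \<phi>
    using V.basis_dual[OF basis, of "\<lambda>b. \<phi> (inv_into (tuples012 N) ?bra b)"] inj by auto
  have vec_eqI: "u = w" if "u \<in> carrier_vec ?D" "w \<in> carrier_vec ?D" "u - w = 0\<^sub>v ?D" for u w :: "complex vec"
    using that by (auto simp: vec_eq_iff)
  have \<eta>: "\<eta> \<noteq> 0"
  proof
    assume "\<eta> = 0"
    \<comment> \<open>The covector for this \<open>h\<close> contains
      \<open>T (\<xi> 1) = 0\<close>, yet duality yields a vector pairing to 1 with it.\<close>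
    define h where "h n = (if n = 1 then 1 else 0 :: nat)" for n :: nat
    have h: "h \<in> tuples012 N" using N_pos by (auto simp: h_def tuples012_def)
    obtain t where t: "t \<in> carrier_vec ?D" "\<forall>h\<in>tuples012 N. ?bra h \<bullet> t = 1"
      using dual[of "\<lambda>_. 1"] by blast
    have "powprod h N = 0"
      using N_pos T_eta_zero[OF \<open>\<eta> = 0\<close>, of 1] by (intro powprod_zero[of 1]) (auto simp: h_def)
    then have "?bra h \<bullet> t = 0" by (simp add: SoV_covector_scalar_prod[OF S t(1)])
    with t(2) h show False by auto
  qed
  interpret generic_spin_chain site_unit \<eta> \<xi> K N
    using \<eta> xi_generic by unfold_locales blast+
  \<comment> \<open>If \<open>S \<bullet> v\<close> were 0, every SoV coordinate of \<open>v\<close>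
    would vanish.\<close>
  have overlap: "S \<bullet> v \<noteq> 0" if "is_common_eigenvector ?D ?T t v" for t v
    using separates[of v] SoV_covector_eigenvector[OF S that] that
    by (auto simp: is_common_eigenvector_def)
  have "t \<in> t1_of N \<xi> K ` Sigma_T N \<eta> \<xi> K" if "is_common_eigenvector ?D ?T t v" for t v
  proof -
    have v: "v \<in> carrier_vec ?D" "v \<noteq> 0\<^sub>v ?D" and eig: "\<And>z. app (T z) (vec_fun v) = (\<lambda>p. t z * vec_fun v p)"
      using that eigenvector_iff by (auto simp: is_common_eigenvector_def)
    obtain p where "p < ?D" "v $ p \<noteq> 0" using v by (metis carrier_vecD eq_vecI index_zero_vec)
    then have "vec_fun v p \<noteq> 0" using v by (simp add: vec_fun_def)
    from eigenvalue_in_Sigma_T[OF eig this] show ?thesis by blast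
  qed
  moreover have "t1_of N \<xi> K x \<in> eigenvalues_family ?D ?T" if x: "x \<in> Sigma_T N \<eta> \<xi> K" for x
  proof -
    obtain v where v: "v \<in> carrier_vec ?D" "\<And>h. h \<in> tuples012 N \<Longrightarrow> ?bra h \<bullet> v = (\<Prod>n\<in>{1..N}. x n ^ h n)"
      using dual[of "\<lambda>h. \<Prod>n\<in>{1..N}. x n ^ h n"] by blast
    \<comment> \<open>The matrix element is defined for all exponents \<open>h\<close>, not only
      those up to 2, so that raising an exponent is always meaningful.\<close>
    define m where "m h A = (\<Sum>p<?D. S $ p * app (powprod h N * A) (vec_fun v) p)" for h A
    have bra_T: "?bra h \<bullet> (?T z *\<^sub>v v) = t1_of N \<xi> K x z * (?bra h \<bullet> v)" if h: "h \<in> tuples012 N" for h z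
    proof -
      have "?T z *\<^sub>v v \<in> carrier_vec ?D" unfolding T1K_eq_opmat by (rule mult_mat_vec_carrier[OF opmat_carrier v(1)])
      then have "?bra h \<bullet> (?T z *\<^sub>v v) = m h (T z)"
        by (simp add: SoV_covector_scalar_prod[OF S] m_def T1K_eq_opmat vec_fun_opmat[OF v(1) preserves_T])
      also have "\<dots> = t1_of N \<xi> K x z * (\<Prod>n\<in>{1..N}. x n ^ h n)"
      proof (rule matrix_element_T[OF _ _ _ _ x h])
        fix h A B c a
        show "m h (A + B) = m h A + m h B"
          by (simp only: m_def distrib_left app_simps sum.distrib)
        show "m h (c *\<^sub>c A) = c * m h A"
          by (simp only: m_def mult_scale_right app_simps sum_distrib_left mult.left_commute)
        show "m h (T (\<xi> a) * A) = m (h(a := Suc (h a))) A" if "a \<in> {1..N}"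
          unfolding m_def mult.assoc[symmetric] powprod_T[OF that order.refl] ..
        show "m h 1 = (\<Prod>n\<in>{1..N}. x n ^ h n)" if "h \<in> tuples012 N"
          using v(2)[OF that] SoV_covector_scalar_prod[OF S v(1)] by (simp add: m_def)
      qed
      finally show ?thesis using v(2)[OF h] by simp
    qed
    have "?T z *\<^sub>v v = t1_of N \<xi> K x z \<cdot>\<^sub>v v" for z
    proof -
      have Tv: "?T z *\<^sub>v v \<in> carrier_vec ?D" unfolding T1K_eq_opmat by (rule mult_mat_vec_carrier[OF opmat_carrier v(1)])
      have "?T z *\<^sub>v v - t1_of N \<xi> K x z \<cdot>\<^sub>v v = 0\<^sub>v ?D"
      proof (rule separates)
        fix h assume h: "h \<in> tuples012 N"
        have "?bra h \<in> carrier_vec ?D" using basis h by (auto simp: V.basis_def)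
        then show "?bra h \<bullet> (?T z *\<^sub>v v - t1_of N \<xi> K x z \<cdot>\<^sub>v v) = 0"
          using Tv v(1) bra_T[OF h, of z] by (simp add: scalar_prod_minus_distrib[of _ ?D])
      qed (use Tv v in auto)
      with Tv smult_carrier_vec[THEN iffD2, OF v(1)] show ?thesis by (rule vec_eqI)
    qed
    \<comment> \<open>At \<open>h = 0\<close> the prescribed coordinate is the empty product
      1.\<close>
    moreover have "v \<noteq> 0\<^sub>v ?D"
    proof
      assume "v = 0\<^sub>v ?D"
      moreover have "(\<lambda>_. 0) \<in> tuples012 N" by (simp add: tuples012_def)
      moreover have "?bra (\<lambda>_. 0) \<in> carrier_vec ?D"
        using basis calculation(2) by (auto simp: V.basis_def)
      ultimately show False using v(2)[of "\<lambda>_. 0"] by simp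
    qed
    ultimately show ?thesis
      using v(1) by (auto simp: eigenvalues_family_def is_common_eigenvector_def)
  qed
  ultimately have spectrum: "eigenvalues_family ?D ?T = t1_of N \<xi> K ` Sigma_T N \<eta> \<xi> K"
    by (auto simp: eigenvalues_family_def)
  have simple: "w = ((S \<bullet> w) / (S \<bullet> v)) \<cdot>\<^sub>v v"
    if v: "is_common_eigenvector ?D ?T t v" and w: "is_common_eigenvector ?D ?T t w" for t v w
  proof -
    let ?c = "(S \<bullet> w) / (S \<bullet> v)"
    have vc: "v \<in> carrier_vec ?D" and wc: "w \<in> carrier_vec ?D"
      using v w by (auto simp: is_common_eigenvector_def)
    have "w - ?c \<cdot>\<^sub>v v = 0\<^sub>v ?D"
    proof (rule separates)
      fix h assume h: "h \<in> tuples012 N"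
      have "?bra h \<in> carrier_vec ?D" using basis h by (auto simp: V.basis_def)
      then show "?bra h \<bullet> (w - ?c \<cdot>\<^sub>v v) = 0"
        using vc wc overlap[OF v]
        by (simp add: scalar_prod_minus_distrib[of _ ?D] SoV_covector_eigenvector[OF S v] SoV_covector_eigenvector[OF S w])
    qed (use vc wc in auto)
    with wc smult_carrier_vec[THEN iffD2, OF vc] show ?thesis by (rule vec_eqI)
  qed
  have "\<exists>v. is_common_eigenvector ?D ?T t v \<and>
      (\<forall>h \<in> tuples012 N. ?bra h \<bullet> v = (\<Prod>n \<in> {1..N}. t (\<xi> n) ^ h n))"
    if t: "t \<in> eigenvalues_family ?D ?T" for t
  proof -
    obtain v where v: "is_common_eigenvector ?D ?T t v" using t by (auto simp: eigenvalues_family_def)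
    \<comment> \<open>Normalising to \<open>S \<bullet> v = 1\<close> removes the common factor from
      the SoV coordinates.\<close>
    let ?c = "1 / (S \<bullet> v)"
    have vc: "v \<in> carrier_vec ?D" using v by (simp add: is_common_eigenvector_def)
    have "?T z *\<^sub>v (?c \<cdot>\<^sub>v v) = t z \<cdot>\<^sub>v (?c \<cdot>\<^sub>v v)" for z
      using v vc opmat_carrier[of ?D "T z"]
      by (simp add: is_common_eigenvector_def T1K_eq_opmat mult_mat_vec[of _ ?D ?D] smult_smult_assoc mult.commute)
    moreover have "?c \<cdot>\<^sub>v v \<noteq> 0\<^sub>v ?D"
      using v overlap[OF v] by (auto simp: is_common_eigenvector_def vec_eq_iff)
    ultimately have eig: "is_common_eigenvector ?D ?T t (?c \<cdot>\<^sub>v v)"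
      using vc by (auto simp: is_common_eigenvector_def)
    have "S \<bullet> (?c \<cdot>\<^sub>v v) = 1"
      using S vc overlap[OF v] by simp
    then show ?thesis
      using eig SoV_covector_eigenvector[OF S eig] by (intro exI[of _ "?c \<cdot>\<^sub>v v"]) simp
  qed
  moreover have "w_simple_family ?D ?T"
    unfolding w_simple_family_def using simple by blast
  ultimately show ?thesis using spectrum by blast
qed

end
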